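(* Let $m\ge 1$ be an integer, $c>0$, let $T>0$ be fixed, and let the ratio $\lambda=c\Delta t/h_x$ be fixed with $1>\lambda>0$. Suppose $g_0\in H^{2m+1}_{\rm per}$ and $g_1\in H^{2m}_{\rm per}$. Let $(u,v)$ be the $2\pi$-periodic solution of $u_t=v$, $v_t=c^2u_{xx}$, $u(\cdot,0)=g_0$, $v(\cdot,0)=g_1$, let $u^n=u(\cdot,t_n)$, $v^n=v(\cdot,t_n)$ with $t_n=n\Delta t$, and let $(p^n,q^n)$, $n=0,\tfrac12,1,\tfrac32,\dots$, be the approximations produced by the dissipative Hermite method with $2\pi$-periodic boundary conditions (defined in the context). Then there is a constant $C$, independent of $h_x$, such that for all $n$ with $t_n\le T$, $$\left\|\frac{d}{dx}(u^n-p^n)\right\|+\|v^n-q^n\|\le C\,h_x^{2m-1}\left(\left\|\frac{d^{2m+1}g_0}{dx^{2m+1}}\right\|+\left\|\frac{d^{2m}g_1}{dx^{2m}}\right\|\right).$$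
   Context: Functions are $2\pi$-periodic in one space variable; $\|\cdot\|$ is the $L_2$ norm on $[-\pi,\pi]$, and $H^q_{\rm per}$ is the Sobolev space of $2\pi$-periodic functions with $q$ derivatives in $L_2$. Grids: let $n_x$ be a positive integer, $h_x=2\pi/n_x$, $x_i=-\pi+ih_x$. The primal grid consists of the nodes $x_i$ with integer $i$, the dual grid of the nodes $x_i$ with half-integer $i$ (indices understood periodically). At times $t_n=n\Delta t$ with $n=0,1,2,\dots$ data live on the primal grid; with $n=\tfrac12,\tfrac32,\dots$ they live on the dual grid. The solution is advanced by half steps $\Delta t/2$, alternating between the grids. Hermite interpolation: for an integer $k\ge0$ and a grid (primal or dual), $\mathcal I_k f$ is the piecewise polynomial that on each interval $[x_i,x_{i+1}]$ between consecutive nodes of the grid equals the unique polynomial of degree at most $2k+1$ whose derivatives of orders $0,\dots,k$ at $x_i$ and at $x_{i+1}$ agree with those of $f$. The grid is suppressed in the notation; it is always the grid on which data live at the time level being computed. Evolution: $\mathcal S$ denotes the exact solution operator over a time interval of length $\Delta t/2$ of the $2\pi$-periodic system $u_t=v$, $v_t=c^2u_{xx}$, mapping $(u(\cdot,t),v(\cdot,t))$ to $(u(\cdot,t+\Delta t/2),v(\cdot,t+\Delta t/2))$. Dissipative Hermite method: $p^0=\mathcal I_m g_0$ and $q^0=\mathcal I_{m-1}g_1$ (primal grid), and for $n=0,\tfrac12,1,\dots$ $$\begin{pmatrix}p^{n+1/2}\\ q^{n+1/2}\end{pmatrix}=\begin{pmatrix}\mathcal I_m&0\\0&\mathcal I_{m-1}\end{pmatrix}\mathcal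 S\begin{pmatrix}p^n\\ q^n\end{pmatrix},$$ where the interpolation at step $n+\tfrac12$ uses the dual grid if $n$ is an integer and the primal grid if $n$ is a half-integer. The constant $C$ may depend on $m$, $c$, $T$ and on the fixed ratio $\lambda$. *)

theory Defs
  imports "HOL-Analysis.Analysis"
begin

section \<open>Periodic Lebesgue and Sobolev spaces\<close>

definition periodic :: "(real \<Rightarrow> real) \<Rightarrow> bool" where
  "periodic f \<longleftrightarrow> (\<forall>x. f (x + 2 * pi) = f x)"

definition L2_per :: "(real \<Rightarrow> real) set" where
  "L2_per = {f. periodic f \<and> f \<in> borel_measurable lebesgue \<and>
                set_integrable lebesgue {-pi..pi} (\<lambda>x. (f x)\<^sup>2)}"

definition L2_norm :: "(real \<Rightarrow> real) \<Rightarrow> real" where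
  "L2_norm f = sqrt (LINT x:{-pi..pi}|lebesgue. (f x)\<^sup>2)"

text \<open>
  Elements of the Sobolev spaces are functions rather than classes modulo null sets: Hermite
  interpolation needs point values. In one dimension, \<open>f\<close> has the weak derivative \<open>w\<close> in
  \<open>L2_per\<close> and is the continuous representative of its class exactly if \<open>f\<close> is an indefinite
  integral of \<open>w\<close>. So \<open>has_sobolev_deriv q f w\<close> says that \<open>f\<close> has classical derivatives of
  orders less than \<open>q\<close>, that the one of order \<open>q - 1\<close> is absolutely continuous, and that \<open>w\<close> in
  \<open>L2_per\<close> is the derivative of order \<open>q\<close>; the function \<open>w\<close> is determined up to a null set.
\<close>

primrec has_sobolev_deriv :: "nat \<Rightarrow> (real \<Rightarrow> real) \<Rightarrow> (real \<Rightarrow> real) \<Rightarrow> bool" where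
  "has_sobolev_deriv 0 f w \<longleftrightarrow> f \<in> L2_per \<and> w = f"
| "has_sobolev_deriv (Suc q) f w \<longleftrightarrow>
     f \<in> L2_per \<and>
     (\<exists>f'. f' \<in> L2_per \<and> (\<forall>a b. a \<le> b \<longrightarrow> f b - f a = (LINT x:{a..b}|lebesgue. f' x)) \<and>
           has_sobolev_deriv q f' w)"

definition H_per :: "nat \<Rightarrow> (real \<Rightarrow> real) set" where
  "H_per q = {f. \<exists>w. has_sobolev_deriv q f w}"

definition sobolev_deriv :: "nat \<Rightarrow> (real \<Rightarrow> real) \<Rightarrow> real \<Rightarrow> real" where
  "sobolev_deriv q f = (SOME w. has_sobolev_deriv q f w)"

section \<open>The wave equation\<close>

text \<open>
  A pair \<open>(u, v)\<close> with \<open>u t x\<close>, \<open>v t x\<close> is a solution of \<open>u\<^sub>t = v\<close>, \<open>v\<^sub>t = c\<^sup>2 u\<^sub>x\<^sub>x\<close> on \<open>t \<ge> 0\<close>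
  if the time-integrated equations hold:
  \<open>u(t) = u(0) + \<integral>\<^sub>0\<^sup>t v ds\<close> and \<open>v(t) = v(0) + c\<^sup>2 \<partial>\<^sub>x\<^sup>2 \<integral>\<^sub>0\<^sup>t u ds\<close> (mild solutions).
  Classical solutions are solutions in this sense, see \<open>classical_imp_wave_solution\<close>. The weaker
  notion is needed because the solution operator is applied to piecewise polynomials: initial
  data with \<open>u\<close> only once and \<open>v\<close> zero times continuously differentiable have a (unique)
  solution here, given by d'Alembert's formula, but in general no classical one.
\<close>

definition wave_solution ::
    "real \<Rightarrow> (real \<Rightarrow> real \<Rightarrow> real) \<Rightarrow> (real \<Rightarrow> real \<Rightarrow> real) \<Rightarrow> bool" where
  "wave_solution c u v \<longleftrightarrow>
     continuous_on ({0..} \<times> UNIV) (\<lambda>(t, x). u t x) \<and>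
     continuous_on ({0..} \<times> UNIV) (\<lambda>(t, x). v t x) \<and>
     (\<forall>t\<ge>0. periodic (u t) \<and> periodic (v t)) \<and>
     (\<forall>t\<ge>0. \<forall>x. u t x = u 0 x + integral {0..t} (\<lambda>s. v s x)) \<and>
     (\<forall>t\<ge>0. \<exists>W' W''. \<forall>x.
        ((\<lambda>y. integral {0..t} (\<lambda>s. u s y)) has_real_derivative W' x) (at x) \<and>
        (W' has_real_derivative W'' x) (at x) \<and>
        v t x = v 0 x + c\<^sup>2 * W'' x)"

definition wave_evolution ::
    "real \<Rightarrow> real \<Rightarrow> (real \<Rightarrow> real) \<times> (real \<Rightarrow> real) \<Rightarrow> (real \<Rightarrow> real) \<times> (real \<Rightarrow> real)" where
  "wave_evolution c \<tau> fg =
     (THE z. \<exists>u v. wave_solution c u v \<and> (u 0, v 0) = fg \<and> z = (u \<tau>, v \<tau>))"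

lemma classical_imp_wave_solution:
  fixes u v ux uxx :: "real \<Rightarrow> real \<Rightarrow> real"
  assumes cont:
      "continuous_on ({0..} \<times> UNIV) (\<lambda>(t, x). u t x)"
      "continuous_on ({0..} \<times> UNIV) (\<lambda>(t, x). v t x)"
      "continuous_on ({0..} \<times> UNIV) (\<lambda>(t, x). ux t x)"
      "continuous_on ({0..} \<times> UNIV) (\<lambda>(t, x). uxx t x)"
    and per: "\<And>t. 0 \<le> t \<Longrightarrow> periodic (u t) \<and> periodic (v t)"
    and ux: "\<And>t x. 0 \<le> t \<Longrightarrow> (u t has_real_derivative ux t x) (at x)"
    and uxx: "\<And>t x. 0 \<le> t \<Longrightarrow> (ux t has_real_derivative uxx t x) (at x)"
    and ut: "\<And>t x. 0 \<le> t \<Longrightarrow> ((\<lambda>s. u s x) has_real_derivative v t x) (at t within {0..})"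
    and vt: "\<And>t x. 0 \<le> t \<Longrightarrow>
               ((\<lambda>s. v s x) has_real_derivative c\<^sup>2 * uxx t x) (at t within {0..})"
  shows "wave_solution c u v"
proof -
  have slice: "continuous_on {0..t} (\<lambda>s. g s x)"
    if "continuous_on ({0..} \<times> UNIV) (\<lambda>(t, x). g t x)" for g :: "real \<Rightarrow> real \<Rightarrow> real" and t x
  proof -
    have "continuous_on {0..t} ((\<lambda>(t, x). g t x) \<circ> (\<lambda>s. (s, x)))"
      by (rule continuous_on_compose)
         (auto intro!: continuous_intros continuous_on_subset[OF that])
    then show ?thesis by (simp add: o_def)
  qed
  have swap: "continuous_on (UNIV \<times> cbox 0 t) (\<lambda>(x, s). g s x)"
    if "continuous_on ({0..} \<times> UNIV) (\<lambda>(t, x). g t x)" for g :: "real \<Rightarrow> real \<Rightarrow> real" and t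
  proof -
    have "continuous_on (UNIV \<times> cbox 0 t) ((\<lambda>(t, x). g t x) \<circ> (\<lambda>p. (snd p, fst p)))"
      by (rule continuous_on_compose)
         (auto intro!: continuous_intros continuous_on_subset[OF that])
    then show ?thesis by (simp add: o_def case_prod_beta)
  qed
  have ftc: "(g' has_integral g t - g 0) {0..t}"
    if "0 \<le> t" "\<And>s. 0 \<le> s \<Longrightarrow> (g has_real_derivative g' s) (at s within {0..})"
    for g g' :: "real \<Rightarrow> real" and t
  proof (rule fundamental_theorem_of_calculus[OF that(1)])
    fix s assume "s \<in> {0..t}"
    then have "(g has_real_derivative g' s) (at s within {0..t})"
      using that(2)[of s] by (auto elim!: DERIV_subset)
    then show "(g has_vector_derivative g' s) (at s within {0..t})"
      by (simp add: has_real_derivative_iff_has_vector_derivative)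
  qed
  have diff_int: "((\<lambda>y. integral {0..t} (\<lambda>s. g s y)) has_real_derivative
                    integral {0..t} (\<lambda>s. g' s x)) (at x)"
    if "continuous_on ({0..} \<times> UNIV) (\<lambda>(t, x). g t x)"
       "continuous_on ({0..} \<times> UNIV) (\<lambda>(t, x). g' t x)"
       "\<And>t x. 0 \<le> t \<Longrightarrow> (g t has_real_derivative g' t x) (at x)"
    for g g' :: "real \<Rightarrow> real \<Rightarrow> real" and t x
    using leibniz_rule_field_derivative
            [of UNIV 0 t "\<lambda>x s. g s x" "\<lambda>x s. g' s x" x] that(3) swap[OF that(2)]
          integrable_continuous_real[OF slice[OF that(1)]]
    by simp
  have u_int: "u t x = u 0 x + integral {0..t} (\<lambda>s. v s x)" if "0 \<le> t" for t x
    using integral_unique[OF ftc[OF that ut]] by simp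
  have v_int: "v t x = v 0 x + c\<^sup>2 * integral {0..t} (\<lambda>s. uxx s x)" if "0 \<le> t" for t x
    using integral_unique[OF ftc[OF that vt]] by simp
  show ?thesis
    unfolding wave_solution_def
  proof (intro conjI allI impI)
    fix t :: real assume "0 \<le> t"
    show "\<exists>W' W''. \<forall>x.
        ((\<lambda>y. integral {0..t} (\<lambda>s. u s y)) has_real_derivative W' x) (at x) \<and>
        (W' has_real_derivative W'' x) (at x) \<and>
        v t x = v 0 x + c\<^sup>2 * W'' x"
      using diff_int[OF cont(1,3) ux] diff_int[OF cont(3,4) uxx] v_int[OF \<open>0 \<le> t\<close>]
      by (intro exI[of _ "\<lambda>x. integral {0..t} (\<lambda>s. ux s x)"]
                exI[of _ "\<lambda>x. integral {0..t} (\<lambda>s. uxx s x)"]) simp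
  qed (rule cont(1) cont(2) u_int per[THEN conjunct1] per[THEN conjunct2] | assumption)+
qed

section \<open>Hermite interpolation\<close>

definition hermite_poly :: "nat \<Rightarrow> real \<Rightarrow> real \<Rightarrow> (real \<Rightarrow> real) \<Rightarrow> real poly" where
  "hermite_poly k a b f =
     (THE P. degree P \<le> 2 * k + 1 \<and>
        (\<forall>j\<le>k. poly ((pderiv ^^ j) P) a = (deriv ^^ j) f a \<and>
               poly ((pderiv ^^ j) P) b = (deriv ^^ j) f b))"

definition mesh_size :: "nat \<Rightarrow> real" where
  "mesh_size nx = 2 * pi / real nx"

definition grid_node :: "nat \<Rightarrow> real \<Rightarrow> real" where
  "grid_node nx i = - pi + i * mesh_size nx"

text \<open>
  The grid with offset \<open>\<sigma>\<close> consists of the nodes \<open>grid_node nx (j + \<sigma>)\<close> for all integers \<open>j\<close>: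
  \<open>\<sigma> = 0\<close> is the primal and \<open>\<sigma> = 1/2\<close> the dual grid. With \<open>i\<close> as below, \<open>x\<close> lies in the cell from
  \<open>grid_node nx i\<close> to \<open>grid_node nx (i + 1)\<close>; at the nodes the two adjacent polynomials agree.
\<close>

definition hermite_interp :: "nat \<Rightarrow> real \<Rightarrow> nat \<Rightarrow> (real \<Rightarrow> real) \<Rightarrow> real \<Rightarrow> real" where
  "hermite_interp nx \<sigma> k f x =
     (let i = of_int \<lfloor>(x + pi) / mesh_size nx - \<sigma>\<rfloor> + \<sigma>
      in poly (hermite_poly k (grid_node nx i) (grid_node nx (i + 1)) f) x)"

section \<open>The dissipative Hermite method\<close>

text \<open>Time levels are counted in half steps: index \<open>k\<close> stands for \<open>n = k/2\<close>.\<close>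

definition grid_offset :: "nat \<Rightarrow> real" where
  "grid_offset k = (if even k then 0 else 1/2)"

primrec hermite_method ::
    "nat \<Rightarrow> real \<Rightarrow> nat \<Rightarrow> real \<Rightarrow> (real \<Rightarrow> real) \<Rightarrow> (real \<Rightarrow> real) \<Rightarrow>
     nat \<Rightarrow> (real \<Rightarrow> real) \<times> (real \<Rightarrow> real)" where
  "hermite_method m c nx dt g0 g1 0 =
     (hermite_interp nx (grid_offset 0) m g0, hermite_interp nx (grid_offset 0) (m - 1) g1)"
| "hermite_method m c nx dt g0 g1 (Suc k) =
     (let (U, V) = wave_evolution c (dt / 2) (hermite_method m c nx dt g0 g1 k)
      in (hermite_interp nx (grid_offset (Suc k)) m U,
          hermite_interp nx (grid_offset (Suc k)) (m - 1) V))"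

end

theory Submission
  imports Defs
begin

text \<open>Let \<open>S\<close> be the solution operator over half a step, \<open>I\<close> the pair of Hermite interpolations and
  \<open>|(u, v)|\<^sub>j\<^sup>2 = c\<^sup>2 \<parallel>D\<^sup>j\<^sup>+\<^sup>1 u\<parallel>\<^sup>2 + \<parallel>D\<^sup>j v\<parallel>\<^sup>2\<close>. Then \<open>S\<close> preserves every \<open>|\<cdot>|\<^sub>j\<close>, and \<open>I\<close> is an orthogonal projection
  for \<open>|\<cdot>|\<^sub>m\<close>. For the error \<open>e\<^sub>n\<close> and the exact solution \<open>w\<close> this gives the Pythagorean identity
  \<open>|e\<^sub>n\<^sub>+\<^sub>1|\<^sub>m\<^sup>2 = |(1 - I) w\<^sub>n\<^sub>+\<^sub>1|\<^sub>m\<^sup>2 + |e\<^sub>n|\<^sub>m\<^sup>2 - \<theta>\<^sub>n\<^sub>+\<^sub>1\<^sup>2\<close> with \<open>\<theta>\<^sub>n\<^sub>+\<^sub>1 = |(1 - I) S e\<^sub>n|\<^sub>m\<close>, where the first term is at most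
  \<open>\<eta>\<^sup>2 = h\<^sup>2\<^sup>m |w\<^sub>0|\<^sub>2\<^sub>m\<^sup>2\<close>; so the \<open>\<theta>\<close> are square summable up to \<open>n \<eta>\<^sup>2\<close>. In the energy norm \<open>|\<cdot>|\<^sub>0\<close> a step adds
  at most \<open>h\<^sup>m (\<eta> + \<theta>\<^sub>n\<^sub>+\<^sub>1)\<close>, since a function whose jets vanish at the nodes loses a factor \<open>h\<close> per
  derivative. Summing over the \<open>O(1/h)\<close> steps gives \<open>O(h\<^sup>2\<^sup>m\<^sup>-\<^sup>1)\<close>.\<close>

section \<open>Locally square integrable functions\<close>

text \<open>Interpolation is not stable in the energy norm, so errors cannot simply be accumulated
  there. In \<open>|.|_m\<close> it is stable, but using only
  \<open>|e_n|_m \<le> sqrt n * \<eta>\<close> at each step would bound every \<theta> by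
  \<open>sqrt n * \<eta>\<close> and lose half a power of \<open>h\<close> in the sum. Keeping the
  subtracted square of \<theta> as a budget shared by all steps recovers it. The exponents: the
  regularity \<open>2m+1 = (m+1) + m\<close> leaves \<open>m\<close> derivatives beyond the order at
  which the interpolant is a best approximation, which gives the \<open>h^m\<close> in \<eta>.
  Descending from order \<open>m+1\<close> to the energy gives another \<open>h^m\<close>, and the
  number of steps costs one power. The technical obstacle is that the derivative of order
  \<open>m+1\<close> of the numerical solution jumps at the nodes, and the evolution carries the
  jumps into the interior of cells. All derivatives are therefore carried along as explicit
  densities, and d'Alembert's formula is applied at every order. That this formula is the solution
  operator requires uniqueness for mild solutions.\<close>

definition locally_L2 :: "(real \<Rightarrow> real) \<Rightarrow> bool" where
  "locally_L2 f \<longleftrightarrow>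
     f \<in> borel_measurable lebesgue \<and> (\<forall>a b. (\<lambda>x. (f x)\<^sup>2) integrable_on {a..b})"

lemma locally_L2_square_integrable: "locally_L2 f \<Longrightarrow> (\<lambda>x. (f x)\<^sup>2) integrable_on {a..b}"
  by (simp add: locally_L2_def)

lemma locally_L2_mult_absolutely_integrable:
  assumes "locally_L2 f" "locally_L2 g"
  shows "(\<lambda>x. f x * g x) absolutely_integrable_on {a..b}"
proof (rule measurable_bounded_by_integrable_imp_absolutely_integrable
    [where g = "\<lambda>x. (f x)\<^sup>2 + (g x)\<^sup>2"])
  show "(\<lambda>x. f x * g x) \<in> borel_measurable (lebesgue_on {a..b})"
    using assms unfolding locally_L2_def
    by (intro measurable_restrict_space1 borel_measurable_times) auto
  show "(\<lambda>x. (f x)\<^sup>2 + (g x)\<^sup>2) integrable_on {a..b}"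
    using assms by (intro integrable_add) (auto simp: locally_L2_def)
  fix x
  have "\<bar>f x * g x\<bar> \<le> (f x)\<^sup>2 + (g x)\<^sup>2"
  proof -
    have "0 \<le> \<bar>f x\<bar> * \<bar>g x\<bar>" by simp
    then show ?thesis
      using sum_squares_bound[of "\<bar>f x\<bar>" "\<bar>g x\<bar>"] unfolding abs_mult power2_abs by linarith
  qed
  then show "norm (f x * g x) \<le> (f x)\<^sup>2 + (g x)\<^sup>2" by simp
qed auto

lemma locally_L2_mult_integrable:
  "locally_L2 f \<Longrightarrow> locally_L2 g \<Longrightarrow> (\<lambda>x. f x * g x) integrable_on {a..b}"
  using locally_L2_mult_absolutely_integrable set_lebesgue_integral_eq_integral(1) by blast

lemma locally_L2_continuous:
  assumes "continuous_on UNIV f"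
  shows "locally_L2 f"
  unfolding locally_L2_def
proof (intro conjI allI)
  show "f \<in> borel_measurable lebesgue"
    using borel_measurable_continuous_onI[OF assms] by (simp add: measurable_completion)
  fix a b
  have "continuous_on {a..b} f" by (rule continuous_on_subset[OF assms]) simp
  then show "(\<lambda>x. (f x)\<^sup>2) integrable_on {a..b}"
    by (intro integrable_continuous_real continuous_on_power)
qed

lemma locally_L2_const [simp]: "locally_L2 (\<lambda>x. k)"
  by (intro locally_L2_continuous continuous_intros)

lemma locally_L2_poly [simp]: "locally_L2 (poly p)"
  by (intro locally_L2_continuous continuous_intros)

lemma locally_L2_absolutely_integrable: "locally_L2 f \<Longrightarrow> f absolutely_integrable_on {a..b}"
  using locally_L2_mult_absolutely_integrable[of f "\<lambda>_. 1"] by simp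

lemma locally_L2_integrable: "locally_L2 f \<Longrightarrow> f integrable_on {a..b}"
  using locally_L2_mult_integrable[of f "\<lambda>_. 1"] by simp

lemma locally_L2_cmult [intro]: "locally_L2 f \<Longrightarrow> locally_L2 (\<lambda>x. k * f x)"
  unfolding locally_L2_def by (auto simp: power_mult_distrib intro!: integrable_on_mult_right)

lemma locally_L2_add [intro]:
  assumes "locally_L2 f" "locally_L2 g"
  shows "locally_L2 (\<lambda>x. f x + g x)"
  unfolding locally_L2_def
proof (intro conjI allI)
  show "(\<lambda>x. f x + g x) \<in> borel_measurable lebesgue"
    using assms by (auto simp: locally_L2_def)
  fix a b :: real
  have "(\<lambda>x. ((f x)\<^sup>2 + 2 * (f x * g x)) + (g x)\<^sup>2) integrable_on {a..b}"
    using assms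
    by (intro integrable_add integrable_on_mult_right locally_L2_mult_integrable
        locally_L2_square_integrable)
  then show "(\<lambda>x. (f x + g x)\<^sup>2) integrable_on {a..b}"
    by (simp add: power2_sum algebra_simps)
qed

lemma locally_L2_diff [intro]:
  "locally_L2 f \<Longrightarrow> locally_L2 g \<Longrightarrow> locally_L2 (\<lambda>x. f x - g x)"
  using locally_L2_add[of f "\<lambda>x. (-1) * g x"] locally_L2_cmult[of g "-1"] by simp

lemma locally_L2_divide [intro]: "locally_L2 f \<Longrightarrow> locally_L2 (\<lambda>x. f x / k)"
  using locally_L2_cmult[of f "inverse k"] by (simp add: field_simps)

lemma locally_L2_shift:
  assumes "locally_L2 f"
  shows "locally_L2 (\<lambda>x. f (x + s))"
  unfolding locally_L2_def
proof (intro conjI allI)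
  show "(\<lambda>x. f (x + s)) \<in> borel_measurable lebesgue"
    using borel_measurable_affine[of f 1 s] assms by (simp add: locally_L2_def add.commute)
  fix a b :: real
  show "(\<lambda>x. (f (x + s))\<^sup>2) integrable_on {a..b}"
    using integrable_shift_real_ivl[of "\<lambda>x. (f x)\<^sup>2" "a + s" "b + s" s] assms
    by (simp add: locally_L2_def)
qed

lemma locally_L2_shift_minus: "locally_L2 f \<Longrightarrow> locally_L2 (\<lambda>x. f (x - s))"
  using locally_L2_shift[of f "-s"] by simp

section \<open>Integrals of periodic functions\<close>

lemma periodic_shift_nat: "periodic f \<Longrightarrow> f (x + of_nat n * (2 * pi)) = f x"
proof (induction n)
  case (Suc n)
  have "f (x + of_nat (Suc n) * (2 * pi)) = f (x + of_nat n * (2 * pi) + 2 * pi)"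
    by (simp add: algebra_simps)
  then show ?case using Suc by (simp add: periodic_def)
qed simp

lemma periodic_shift_int:
  assumes "periodic f"
  shows "f (x + of_int k * (2 * pi)) = f x"
proof (cases k)
  case (nonneg n)
  then show ?thesis using periodic_shift_nat[OF assms] by simp
next
  case (neg n)
  have "x + of_int k * (2 * pi) + of_nat (Suc n) * (2 * pi) = x"
  proof -
    have "of_int k = - (1 + real n)" using neg by simp
    then show ?thesis unfolding \<open>of_int k = - (1 + real n)\<close> by (simp add: algebra_simps)
  qed
  then show ?thesis
    using periodic_shift_nat[OF assms, of "x + of_int k * (2 * pi)" "Suc n"] by metis
qed

lemma integral_shift_real:
  fixes f :: "real \<Rightarrow> real"
  shows "integral {a..b} (\<lambda>x. f (x + s)) = integral {a + s..b + s} f"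
  using integral_shift_real_ivl[of "a + s" s "b + s" f] by simp

text \<open>Induction on symmetric intervals: one translated period is attached at each end until
  the given interval is covered.\<close>

lemma periodic_integrable:
  fixes f :: "real \<Rightarrow> real"
  assumes "periodic f" "f integrable_on {-pi..pi}"
  shows "f integrable_on {a..b}"
proof -
  have step: "f integrable_on {of_int k * (2 * pi) - pi..of_int k * (2 * pi) + pi}" for k
    using integrable_shift_real_ivl[OF assms(2), of "- (of_int k * (2 * pi))"]
      periodic_shift_int[OF assms(1), of _ "-k"]
    by (simp add: algebra_simps)
  have *: "f integrable_on {- pi - real n * (2 * pi)..real n * (2 * pi) + pi}" for n :: nat
  proof (induction n)
    case 0
    then show ?case using assms(2) by simp
  next
    case (Suc n)
    define R where "R = real n * (2 * pi) + pi"
    have R: "0 \<le> R" "real (Suc n) * (2 * pi) + pi = R + 2 * pi"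
        "- pi - real n * (2 * pi) = - R" "- pi - real (Suc n) * (2 * pi) = - R - 2 * pi"
      by (simp_all add: R_def algebra_simps)
    have s: "f integrable_on {R..R + 2 * pi}" "f integrable_on {- R - 2 * pi..- R}"
      using step[of "int (Suc n)"] step[of "- int (Suc n)"] by (simp_all add: R_def algebra_simps)
    have "f integrable_on {- R..R}"
      using Suc by (simp add: R_def algebra_simps)
    then have "f integrable_on {- R..R + 2 * pi}"
      by (rule Henstock_Kurzweil_Integration.integrable_combine[rotated 2]) (use s R in auto)
    then show ?case
      unfolding R by (rule Henstock_Kurzweil_Integration.integrable_combine[rotated 3])
        (use s R in auto)
  qed
  obtain n :: nat where n: "\<bar>a\<bar> + \<bar>b\<bar> \<le> real n" using real_arch_simple by blast
  have "real n * 1 \<le> real n * (2 * pi)"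
    using pi_gt3 by (intro mult_left_mono) auto
  then have "{a..b} \<subseteq> {- pi - real n * (2 * pi)..real n * (2 * pi) + pi}"
    using n pi_gt_zero by (intro atLeastatMost_subset_iff[THEN iffD2] disjI2 conjI) linarith+
  then show ?thesis using * integrable_on_subinterval by blast
qed

text \<open>For \<open>a \<le> b\<close> the two windows complete the same interval
  \<open>[a, b + 2 pi]\<close>; what is missing is \<open>[a, b]\<close> in one case and its
  translate by a period in the other.\<close>

lemma integral_period:
  fixes f :: "real \<Rightarrow> real"
  assumes "periodic f" "\<And>a b. f integrable_on {a..b}"
  shows "integral {a..a + 2 * pi} f = integral {-pi..pi} f"
proof -
  have *: "integral {a..a + 2 * pi} f = integral {b..b + 2 * pi} f" if "a \<le> b" for a b
  proof -
    have "integral {a..b} f + integral {b..b + 2 * pi} f = integral {a..b + 2 * pi} f"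
      by (rule Henstock_Kurzweil_Integration.integral_combine) (use that assms(2) in auto)
    moreover have "integral {a..a + 2 * pi} f + integral {a + 2 * pi..b + 2 * pi} f
        = integral {a..b + 2 * pi} f"
      by (rule Henstock_Kurzweil_Integration.integral_combine) (use that assms(2) in auto)
    moreover have "integral {a + 2 * pi..b + 2 * pi} f = integral {a..b} f"
      using integral_shift_real[of a b f "2 * pi"] assms(1) by (simp add: periodic_def)
    ultimately show ?thesis by simp
  qed
  show ?thesis using *[of a "-pi"] *[of "-pi" a] by (cases "a \<le> -pi") auto
qed

lemma integral_period_shift:
  fixes f :: "real \<Rightarrow> real"
  assumes "periodic f" "\<And>a b. f integrable_on {a..b}"
  shows "integral {-pi..pi} (\<lambda>x. f (x + s)) = integral {-pi..pi} f"
  using integral_period[OF assms, of "-pi + s"] by (simp add: integral_shift_real add.commute)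

text \<open>The bridge from the Lebesgue integral over one period to gauge integrals over arbitrary
  bounded intervals. The local form survives restriction to cells and passage to a primitive, which
  is in general not periodic.\<close>

lemma L2_per_iff: "f \<in> L2_per \<longleftrightarrow> periodic f \<and> locally_L2 f"
proof
  assume f: "f \<in> L2_per"
  then have "(\<lambda>x. (f x)\<^sup>2) integrable_on {-pi..pi}"
    by (auto simp: L2_per_def dest: set_lebesgue_integral_eq_integral(1))
  moreover have "periodic (\<lambda>x. (f x)\<^sup>2)" using f by (auto simp: L2_per_def periodic_def)
  ultimately show "periodic f \<and> locally_L2 f"
    using f periodic_integrable by (auto simp: L2_per_def locally_L2_def)
next
  assume "periodic f \<and> locally_L2 f"
  then show "f \<in> L2_per"
    using locally_L2_mult_absolutely_integrable[of f f]
    by (auto simp: L2_per_def locally_L2_def power2_eq_square)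
qed

lemma L2_norm_eq: "locally_L2 f \<Longrightarrow> L2_norm f = sqrt (integral {-pi..pi} (\<lambda>x. (f x)\<^sup>2))"
  using set_lebesgue_integral_eq_integral(2)
    [OF locally_L2_mult_absolutely_integrable[of f f "-pi" pi]]
  by (simp add: L2_norm_def power2_eq_square)

lemma integral_mono_subinterval:
  fixes f :: "real \<Rightarrow> real"
  assumes "f integrable_on {a..b}" "\<And>x. 0 \<le> f x" "a \<le> c" "d \<le> b"
  shows "integral {c..d} f \<le> integral {a..b} f"
proof (rule integral_subset_le)
  show "f integrable_on {c..d}" by (rule integrable_on_subinterval[OF assms(1)]) (use assms in auto)
qed (use assms in auto)

text \<open>This is the nonnegativity of the variance of \<open>f\<close>.\<close>

lemma integral_square_le:
  assumes "locally_L2 f" "a \<le> b"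
  shows "(integral {a..b} f)\<^sup>2 \<le> (b - a) * integral {a..b} (\<lambda>x. (f x)\<^sup>2)"
proof (cases "a = b")
  case False
  then have ab: "0 < b - a" using assms by simp
  define I where "I = integral {a..b} f"
  define J where "J = integral {a..b} (\<lambda>x. (f x)\<^sup>2)"
  let ?\<mu> = "I / (b - a)"
  have f: "f integrable_on {a..b}" "(\<lambda>x. (f x)\<^sup>2) integrable_on {a..b}"
    using assms by (auto intro: locally_L2_integrable locally_L2_square_integrable)
  have "((\<lambda>x. (f x)\<^sup>2 - 2 * ?\<mu> * f x + ?\<mu>\<^sup>2) has_integral
      (J - 2 * ?\<mu> * I + (b - a) * ?\<mu>\<^sup>2)) {a..b}"
    unfolding I_def J_def
    by (intro has_integral_add has_integral_diff has_integral_mult_right integrable_integral f)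
      (use has_integral_const_real[of "?\<mu>\<^sup>2" a b] assms in \<open>simp add: I_def\<close>)
  then have "0 \<le> J - 2 * ?\<mu> * I + (b - a) * ?\<mu>\<^sup>2"
  proof (rule has_integral_nonneg)
    fix x
    have "(f x)\<^sup>2 - 2 * ?\<mu> * f x + ?\<mu>\<^sup>2 = (f x - ?\<mu>)\<^sup>2"
      by (simp add: power2_diff algebra_simps)
    then show "0 \<le> (f x)\<^sup>2 - 2 * ?\<mu> * f x + ?\<mu>\<^sup>2" by simp
  qed
  also have "J - 2 * ?\<mu> * I + (b - a) * ?\<mu>\<^sup>2 = J - I\<^sup>2 / (b - a)"
  proof -
    have "d * (I / d)\<^sup>2 = I\<^sup>2 / d" "2 * (I / d) * I = 2 * (I\<^sup>2 / d)" if "0 < d" for d :: real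
      using that by (simp_all add: power2_eq_square)
    from this[OF ab] show ?thesis by linarith
  qed
  finally have "I\<^sup>2 / (b - a) \<le> J" by simp
  then show ?thesis
    using ab by (simp add: field_simps I_def J_def)
qed simp

section \<open>Sobolev chains\<close>

text \<open>A function together with its derivatives up to order \<open>q\<close>; the derivative of order \<open>q\<close> is
  only an \<open>L\<^sup>2\<close> density, so it is carried along explicitly instead of being recovered from the
  function by \<open>deriv\<close>.\<close>

definition sobolev_chain :: "nat \<Rightarrow> (nat \<Rightarrow> real \<Rightarrow> real) \<Rightarrow> bool" where
  "sobolev_chain q D \<longleftrightarrow> (\<forall>j\<le>q. locally_L2 (D j)) \<and>
     (\<forall>j<q. \<forall>a b. a \<le> b \<longrightarrow> D j b - D j a = integral {a..b} (D (Suc j)))"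

lemma sobolev_chain_L2: "sobolev_chain q D \<Longrightarrow> j \<le> q \<Longrightarrow> locally_L2 (D j)"
  by (simp add: sobolev_chain_def)

lemma sobolev_chain_diff_eq:
  "sobolev_chain q D \<Longrightarrow> j < q \<Longrightarrow> a \<le> b \<Longrightarrow> D j b - D j a = integral {a..b} (D (Suc j))"
  by (simp add: sobolev_chain_def)

lemma sobolev_chain_mono: "sobolev_chain q D \<Longrightarrow> r \<le> q \<Longrightarrow> sobolev_chain r D"
  by (simp add: sobolev_chain_def)

lemma sobolev_chain_drop: "sobolev_chain (r + q) D \<Longrightarrow> sobolev_chain q (\<lambda>j. D (r + j))"
  by (simp add: sobolev_chain_def)

lemma sobolev_chain_Suc: "sobolev_chain (Suc q) D \<Longrightarrow> sobolev_chain q (\<lambda>j. D (Suc j))"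
  by (simp add: sobolev_chain_def)

lemma integral_difference_continuous:
  fixes F f :: "real \<Rightarrow> real"
  assumes F: "\<And>a b. a \<le> b \<Longrightarrow> F b - F a = integral {a..b} f"
    and f: "\<And>a b. f integrable_on {a..b}"
  shows "continuous_on UNIV F"
proof -
  have "isCont F x" for x
  proof -
    have "continuous_on {x - 1..x + 1} (\<lambda>y. F (x - 1) + integral {x - 1..y} f)"
      by (intro continuous_intros indefinite_integral_continuous_1 f)
    moreover have "F y = F (x - 1) + integral {x - 1..y} f" if "y \<in> {x - 1..x + 1}" for y
      using F[of "x - 1" y] that by simp
    ultimately have "continuous_on {x - 1..x + 1} F"
      by (metis (no_types, lifting) continuous_on_cong)
    then show ?thesis by (rule continuous_on_interior) (simp add: interior_atLeastAtMost_real)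
  qed
  then show ?thesis by (simp add: continuous_at_imp_continuous_on)
qed

lemma sobolev_chain_continuous: "sobolev_chain q D \<Longrightarrow> j < q \<Longrightarrow> continuous_on UNIV (D j)"
  by (rule integral_difference_continuous[OF sobolev_chain_diff_eq
        locally_L2_integrable[OF sobolev_chain_L2]]) auto

lemma integral_difference_has_derivative:
  fixes F f :: "real \<Rightarrow> real"
  assumes F: "\<And>a b. a \<le> b \<Longrightarrow> F b - F a = integral {a..b} f" and f: "continuous_on UNIV f"
  shows "(F has_real_derivative f x) (at x)"
proof -
  have "continuous_on {x - 1..x + 1} f" using f continuous_on_subset by blast
  then have "((\<lambda>y. integral {x - 1..y} f) has_real_derivative f x) (at x within {x - 1..x + 1})"
    by (rule integral_has_real_derivative) simp
  then have "((\<lambda>y. F (x - 1) + integral {x - 1..y} f) has_real_derivative f x)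
      (at x within {x - 1..x + 1})"
    by (auto intro!: derivative_eq_intros)
  then have "(F has_real_derivative f x) (at x within {x - 1..x + 1})"
  proof (rule has_field_derivative_transform_within[where d = 1])
    fix y assume "y \<in> {x - 1..x + 1}"
    then show "F (x - 1) + integral {x - 1..y} f = F y" using F[of "x - 1" y] by simp
  qed simp_all
  then show ?thesis by (simp add: at_within_Icc_at)
qed

text \<open>Strictly below the top order the density \<open>D (Suc j)\<close> is itself an
  indefinite integral, hence continuous, and the fundamental theorem holds at every point.\<close>

lemma sobolev_chain_has_deriv:
  "sobolev_chain q D \<Longrightarrow> Suc j < q \<Longrightarrow> (D j has_real_derivative D (Suc j) x) (at x)"
  by (rule integral_difference_has_derivative)
    (auto intro: sobolev_chain_diff_eq sobolev_chain_continuous)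

text \<open>Hermite interpolation reads its data through \<open>deriv\<close>; this identifies those
  data with entries of the chain.\<close>

lemma sobolev_chain_higher_deriv:
  assumes "sobolev_chain q D" "j < q"
  shows "(deriv ^^ j) (D 0) = D j"
  using assms(2)
proof (induction j)
  case (Suc j)
  then show ?case
    using sobolev_chain_has_deriv[OF assms(1) Suc.prems] by (auto intro: DERIV_imp_deriv)
qed simp

section \<open>Operations on chains\<close>

lemma sobolev_chain_add:
  assumes "sobolev_chain q D" "sobolev_chain q E"
  shows "sobolev_chain q (\<lambda>j x. D j x + E j x)"
  unfolding sobolev_chain_def
proof (intro conjI allI impI)
  fix j and a b :: real assume j: "j < q" "a \<le> b"
  have "integral {a..b} (\<lambda>x. D (Suc j) x + E (Suc j) x)
      = integral {a..b} (D (Suc j)) + integral {a..b} (E (Suc j))"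
    using assms j
    by (intro integral_add locally_L2_integrable sobolev_chain_L2) auto
  then show "D j b + E j b - (D j a + E j a) = integral {a..b} (\<lambda>x. D (Suc j) x + E (Suc j) x)"
    using sobolev_chain_diff_eq[OF assms(1) j] sobolev_chain_diff_eq[OF assms(2) j] by simp
qed (use assms in \<open>auto simp: sobolev_chain_def\<close>)

lemma sobolev_chain_cmult:
  assumes "sobolev_chain q D"
  shows "sobolev_chain q (\<lambda>j x. k * D j x)"
  unfolding sobolev_chain_def
proof (intro conjI allI impI)
  fix j and a b :: real assume j: "j < q" "a \<le> b"
  show "k * D j b - k * D j a = integral {a..b} (\<lambda>x. k * D (Suc j) x)"
    using sobolev_chain_diff_eq[OF assms j] by (simp add: right_diff_distrib[symmetric])
qed (use assms in \<open>auto simp: sobolev_chain_def\<close>)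

lemma sobolev_chain_divide:
  assumes "sobolev_chain q D"
  shows "sobolev_chain q (\<lambda>j x. D j x / k)"
  using sobolev_chain_cmult[OF assms, of "inverse k"] by (simp add: field_simps)

lemma sobolev_chain_diff:
  assumes "sobolev_chain q D" "sobolev_chain q E"
  shows "sobolev_chain q (\<lambda>j x. D j x - E j x)"
  using sobolev_chain_add[OF assms(1) sobolev_chain_cmult[OF assms(2), of "-1"]] by simp

lemma sobolev_chain_shift:
  assumes "sobolev_chain q D"
  shows "sobolev_chain q (\<lambda>j x. D j (x + s))"
  unfolding sobolev_chain_def
proof (intro conjI allI impI)
  fix j and a b :: real assume j: "j < q" "a \<le> b"
  show "D j (b + s) - D j (a + s) = integral {a..b} (\<lambda>x. D (Suc j) (x + s))"
    using sobolev_chain_diff_eq[OF assms j(1), of "a + s" "b + s"] j(2)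
    by (simp add: integral_shift_real)
qed (use assms in \<open>auto simp: sobolev_chain_def intro: locally_L2_shift\<close>)

lemma sobolev_chain_shift_minus:
  "sobolev_chain q D \<Longrightarrow> sobolev_chain q (\<lambda>j x. D j (x - s))"
  using sobolev_chain_shift[of q D "-s"] by simp

lemma sobolev_chain_poly: "sobolev_chain q (\<lambda>j. poly ((pderiv ^^ j) p))"
  unfolding sobolev_chain_def
proof (intro conjI allI impI)
  fix j and a b :: real assume j: "j < q" "a \<le> b"
  have "(poly ((pderiv ^^ Suc j) p) has_integral poly ((pderiv ^^ j) p) b - poly ((pderiv ^^ j) p) a)
      {a..b}"
    using j(2)
  proof (rule fundamental_theorem_of_calculus)
    fix x
    show "(poly ((pderiv ^^ j) p) has_vector_derivative poly ((pderiv ^^ Suc j) p) x)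
        (at x within {a..b})"
      using has_field_derivative_at_within[OF poly_DERIV[of "(pderiv ^^ j) p" x]]
      by (simp add: has_real_derivative_iff_has_vector_derivative[symmetric])
  qed
  then show "poly ((pderiv ^^ j) p) b - poly ((pderiv ^^ j) p) a
      = integral {a..b} (poly ((pderiv ^^ Suc j) p))"
    by (simp add: integral_unique)
qed simp

text \<open>Collects the nested witnesses of the recursive definition into one sequence, so that all
  intermediate derivatives are available together.\<close>

lemma has_sobolev_deriv_iff_chain:
  "has_sobolev_deriv q f w \<longleftrightarrow>
     (\<exists>D. D 0 = f \<and> D q = w \<and> sobolev_chain q D \<and> (\<forall>j\<le>q. periodic (D j)))"
proof (induction q arbitrary: f)
  case 0
  have "\<exists>D :: nat \<Rightarrow> real \<Rightarrow> real. D 0 = f" by (rule exI[of _ "\<lambda>_. f"]) simp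
  then show ?case by (auto simp: L2_per_iff sobolev_chain_def)
next
  case (Suc q)
  have eq: "(LINT x:{a..b}|lebesgue. f' x) = integral {a..b} f'" if "locally_L2 f'" for f' a b
    using locally_L2_absolutely_integrable[OF that] set_lebesgue_integral_eq_integral(2) by blast
  show ?case
  proof
    assume "has_sobolev_deriv (Suc q) f w"
    then obtain f' where f: "f \<in> L2_per" and f': "f' \<in> L2_per"
      "\<And>a b. a \<le> b \<Longrightarrow> f b - f a = (LINT x:{a..b}|lebesgue. f' x)" "has_sobolev_deriv q f' w"
      by auto
    obtain D where D: "D 0 = f'" "D q = w" "sobolev_chain q D" "\<forall>j\<le>q. periodic (D j)"
      using Suc f'(3) by blast
    have "sobolev_chain (Suc q) (case_nat f D)" "\<forall>j\<le>Suc q. periodic (case_nat f D j)"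
      using f f'(1,2) D eq
      by (auto simp: sobolev_chain_def L2_per_iff split: nat.splits)
    then show "\<exists>D. D 0 = f \<and> D (Suc q) = w \<and> sobolev_chain (Suc q) D \<and> (\<forall>j\<le>Suc q. periodic (D j))"
      using D(2) by (intro exI[of _ "case_nat f D"]) simp
  next
    assume "\<exists>D. D 0 = f \<and> D (Suc q) = w \<and> sobolev_chain (Suc q) D \<and> (\<forall>j\<le>Suc q. periodic (D j))"
    then obtain D where D: "D 0 = f" "D (Suc q) = w" "sobolev_chain (Suc q) D"
      "\<forall>j\<le>Suc q. periodic (D j)" by blast
    have "has_sobolev_deriv q (D (Suc 0)) w"
      unfolding Suc using D sobolev_chain_Suc[OF D(3)]
      by (intro exI[of _ "\<lambda>j. D (Suc j)"]) auto
    moreover have L: "D (Suc 0) \<in> L2_per" "f \<in> L2_per"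
      using D sobolev_chain_L2[OF D(3)] by (auto simp: L2_per_iff)
    moreover have "f b - f a = (LINT x:{a..b}|lebesgue. D (Suc 0) x)" if "a \<le> b" for a b
      using sobolev_chain_diff_eq[OF D(3), of 0 a b] that D(1) eq[of "D (Suc 0)" a b] L(1)
      by (simp add: L2_per_iff)
    ultimately show "has_sobolev_deriv (Suc q) f w"
      unfolding has_sobolev_deriv.simps by blast
  qed
qed

text \<open>The density \<open>D (Suc j)\<close> need not be a pointwise derivative, so the product rule is not
  available. The defect of the formula is additive over adjacent intervals and at most a constant
  times the length of the interval times the variation of \<open>D j\<close>; repeated bisection shows that it
  vanishes.\<close>

lemma sobolev_chain_by_parts:
  fixes r :: "real poly"
  assumes D: "sobolev_chain n D" and j: "j < n" and ab: "a \<le> b"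
  shows "integral {a..b} (\<lambda>x. D (Suc j) x * poly r x)
    = D j b * poly r b - D j a * poly r a - integral {a..b} (\<lambda>x. D j x * poly (pderiv r) x)"
proof -
  define \<delta> where "\<delta> x y = D j y * poly r y - D j x * poly r x
    - integral {x..y} (\<lambda>t. D j t * poly (pderiv r) t)
    - integral {x..y} (\<lambda>t. D (Suc j) t * poly r t)" for x y
  define V where "V x y = integral {x..y} (\<lambda>t. \<bar>D (Suc j) t\<bar>)" for x y
  have L: "locally_L2 (D j)" "locally_L2 (D (Suc j))"
    using D j by (auto intro: sobolev_chain_L2)
  have Vi: "(\<lambda>t. \<bar>D (Suc j) t\<bar>) integrable_on {x..y}" for x y
    using locally_L2_absolutely_integrable[OF L(2), of x y]
    by (auto simp: absolutely_integrable_on_def)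
  obtain K where K: "0 \<le> K" "\<And>x. x \<in> {a..b} \<Longrightarrow> \<bar>poly (pderiv r) x\<bar> \<le> K"
  proof -
    have "bounded (poly (pderiv r) ` {a..b})"
      by (intro compact_imp_bounded compact_continuous_image continuous_intros) simp
    then show ?thesis
      unfolding bounded_iff using that[of "max 0 _"] by (metis imageI max.cobounded1 max.coboundedI2 real_norm_def)
  qed
  have bound: "\<bar>\<delta> x y\<bar> \<le> 2 * K * (y - x) * V x y" if xy: "a \<le> x" "x \<le> y" "y \<le> b" for x y
  proof -
    \<comment> \<open>Comparing \<open>r\<close> with its value at the right end and
      \<open>D j\<close> with its value at the left end makes the boundary terms cancel exactly.
      Each of the two remaining integrals is at most \<open>K * (y - x) * V x y\<close>, whence the
      constant \<open>2 * K\<close>.\<close>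
    let ?f = "\<lambda>t. D (Suc j) t * (poly r y - poly r t)"
    let ?g = "\<lambda>t. (D j t - D j x) * poly (pderiv r) t"
    have fi: "?f integrable_on {x..y}" and gi: "?g integrable_on {x..y}"
      by (auto intro!: locally_L2_mult_integrable locally_L2_diff L)
    have r_int: "(poly (pderiv r) has_integral (poly r y - poly r x)) {x..y}"
      using xy(2)
      by (rule fundamental_theorem_of_calculus)
        (simp add: has_real_derivative_iff_has_vector_derivative[symmetric]
            has_field_derivative_at_within[OF poly_DERIV])
    have "integral {x..y} ?f
        = (D j y - D j x) * poly r y - integral {x..y} (\<lambda>t. D (Suc j) t * poly r t)"
      using sobolev_chain_diff_eq[OF D j xy(2)] locally_L2_mult_integrable[OF L(2) locally_L2_poly, of r x y]
        locally_L2_integrable[OF L(2), of x y]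
      by (simp add: right_diff_distrib integral_diff integrable_on_mult_left)
    moreover have "integral {x..y} ?g
        = integral {x..y} (\<lambda>t. D j t * poly (pderiv r) t) - D j x * (poly r y - poly r x)"
      using integral_unique[OF r_int] locally_L2_mult_integrable[OF L(1) locally_L2_poly, of "pderiv r" x y]
        locally_L2_integrable[OF locally_L2_poly, of "pderiv r" x y]
      by (simp add: left_diff_distrib integral_diff integrable_on_mult_right)
    ultimately have "\<delta> x y = integral {x..y} ?f - integral {x..y} ?g"
      by (simp add: \<delta>_def algebra_simps)
    moreover have "norm (integral {x..y} ?f) \<le> integral {x..y} (\<lambda>t. K * (y - x) * \<bar>D (Suc j) t\<bar>)"
    proof (rule integral_norm_bound_integral[OF fi integrable_on_mult_right[OF Vi]])
      fix t assume t: "t \<in> {x..y}"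
      have "norm (poly r y - poly r t) \<le> K * norm (y - t)"
        by (rule field_differentiable_bound[where S = "{a..b}" and f' = "poly (pderiv r)"])
          (use t xy K in \<open>auto intro: has_field_derivative_at_within[OF poly_DERIV]\<close>)
      also have "\<dots> \<le> K * (y - x)" using t K(1) by (intro mult_left_mono) auto
      finally show "norm (?f t) \<le> K * (y - x) * \<bar>D (Suc j) t\<bar>"
        by (simp add: abs_mult mult.commute mult_left_mono)
    qed
    moreover have "norm (integral {x..y} ?g) \<le> integral {x..y} (\<lambda>t. V x y * K)"
    proof (rule integral_norm_bound_integral[OF gi])
      fix t assume t: "t \<in> {x..y}"
      have "\<bar>D j t - D j x\<bar> = \<bar>integral {x..t} (D (Suc j))\<bar>"
        using sobolev_chain_diff_eq[OF D j, of x t] t by simp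
      also have "\<dots> \<le> V x t"
        unfolding V_def
        using integral_norm_bound_integral[OF locally_L2_integrable[OF L(2)] Vi, of x t] by simp
      also have "\<dots> \<le> V x y"
        unfolding V_def by (rule integral_mono_subinterval[OF Vi]) (use t in auto)
      finally show "norm (?g t) \<le> V x y * K"
        using K(2)[of t] t xy by (auto simp: abs_mult intro!: mult_mono)
    qed auto
    moreover have "integral {x..y} (\<lambda>t. K * (y - x) * \<bar>D (Suc j) t\<bar>) = K * (y - x) * V x y"
      unfolding V_def by simp
    moreover have "integral {x..y} (\<lambda>t. V x y * K) = K * (y - x) * V x y"
      using xy by (simp add: mult_ac)
    ultimately show ?thesis by (simp only: real_norm_def)
  qed
  have "\<bar>\<delta> x y\<bar> \<le> 2 * K * (y - x) * V x y / 2 ^ n" if "a \<le> x" "x \<le> y" "y \<le> b" for n x y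
    using that
  proof (induction n arbitrary: x y)
    case 0
    then show ?case using bound by simp
  next
    case (Suc n)
    define z where "z = (x + y) / 2"
    have z: "x \<le> z" "z \<le> y" "z - x = (y - x) / 2" "y - z = (y - x) / 2"
      using Suc.prems by (auto simp: z_def field_simps)
    note comb = Henstock_Kurzweil_Integration.integral_combine[OF z(1,2), symmetric]
    have "\<delta> x y = \<delta> x z + \<delta> z y"
      unfolding \<delta>_def
      using comb[of "\<lambda>t. D j t * poly (pderiv r) t"] comb[of "\<lambda>t. D (Suc j) t * poly r t"]
        locally_L2_mult_integrable L by simp
    moreover have "V x y = V x z + V z y"
      unfolding V_def by (rule comb[OF Vi])
    then have "2 * K * (y - x) * V x y / 2 ^ Suc n
        = 2 * K * ((y - x) / 2) * V x z / 2 ^ n + 2 * K * ((y - x) / 2) * V z y / 2 ^ n"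
      by (simp add: distrib_left add_divide_distrib)
    moreover have "\<bar>\<delta> x z\<bar> \<le> 2 * K * ((y - x) / 2) * V x z / 2 ^ n"
      using Suc.IH[of x z] Suc.prems z by simp
    moreover have "\<bar>\<delta> z y\<bar> \<le> 2 * K * ((y - x) / 2) * V z y / 2 ^ n"
      using Suc.IH[of z y] Suc.prems z by simp
    ultimately show ?case by linarith
  qed
  then have "\<forall>n. \<bar>\<delta> a b\<bar> \<le> 2 * K * (b - a) * V a b / 2 ^ n" using ab by simp
  moreover have "(\<lambda>n. 2 * K * (b - a) * V a b / 2 ^ n) \<longlonglongrightarrow> 0"
    by (rule LIMSEQ_divide_realpow_zero) simp
  ultimately have "\<bar>\<delta> a b\<bar> \<le> 0" by (intro LIMSEQ_le_const) auto
  then show ?thesis by (simp add: \<delta>_def)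
qed

text \<open>Each integration by parts moves one derivative from \<open>E\<close> to \<open>r\<close>
  without boundary terms; after \<open>n\<close> of them \<open>r\<close> is exhausted. This is the
  source of all orthogonality of the interpolation.\<close>

lemma sobolev_chain_orthogonal_poly:
  fixes r :: "real poly"
  assumes "sobolev_chain n E" "a \<le> b" "\<And>j. j < n \<Longrightarrow> E j a = 0 \<and> E j b = 0"
    and "(pderiv ^^ n) r = 0"
  shows "integral {a..b} (\<lambda>x. E n x * poly r x) = 0"
  using assms
proof (induction n arbitrary: r)
  case (Suc n)
  have "integral {a..b} (\<lambda>x. E n x * poly (pderiv r) x) = 0"
  proof (rule Suc.IH)
    show "(pderiv ^^ n) (pderiv r) = 0"
      using Suc.prems(4) by (simp only: funpow_Suc_right o_apply)
  qed (use Suc.prems sobolev_chain_mono[of "Suc n" E n] in auto)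
  then show ?case
    using sobolev_chain_by_parts[OF Suc.prems(1) lessI Suc.prems(2), of r] Suc.prems(3)[of n]
    by simp
qed simp

text \<open>Cauchy-Schwarz for \<open>D j x\<close>, written as the integral of
  \<open>D (Suc j)\<close> from \<open>a\<close> to \<open>x\<close>, gives one factor
  \<open>b - a\<close>; integrating the resulting constant bound over the interval gives the
  other.\<close>

lemma sobolev_chain_poincare_step:
  assumes D: "sobolev_chain q D" and j: "j < q" and ab: "a \<le> b" and 0: "D j a = 0"
  shows "integral {a..b} (\<lambda>x. (D j x)\<^sup>2) \<le> (b - a)\<^sup>2 * integral {a..b} (\<lambda>x. (D (Suc j) x)\<^sup>2)"
proof -
  let ?I = "integral {a..b} (\<lambda>x. (D (Suc j) x)\<^sup>2)"
  have L: "locally_L2 (D j)" "locally_L2 (D (Suc j))"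
    using D j by (auto intro: sobolev_chain_L2)
  note sq = locally_L2_square_integrable[OF L(2), of a b]
  have "integral {a..b} (\<lambda>x. (D j x)\<^sup>2) \<le> integral {a..b} (\<lambda>x. (b - a) * ?I)"
  proof (rule integral_le[OF locally_L2_square_integrable[OF L(1)]])
    fix x assume x: "x \<in> {a..b}"
    have "(D j x)\<^sup>2 = (integral {a..x} (D (Suc j)))\<^sup>2"
      using sobolev_chain_diff_eq[OF D j, of a x] x 0 by simp
    also have "\<dots> \<le> (x - a) * integral {a..x} (\<lambda>x. (D (Suc j) x)\<^sup>2)"
      by (rule integral_square_le[OF L(2)]) (use x in auto)
    also have "\<dots> \<le> (b - a) * ?I"
      by (intro mult_mono integral_mono_subinterval[OF sq] integral_nonneg
          locally_L2_square_integrable L) (use x in auto)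
    finally show "(D j x)\<^sup>2 \<le> (b - a) * ?I" .
  qed auto
  also have "\<dots> = (b - a)\<^sup>2 * ?I" using ab by (simp add: power2_eq_square)
  finally show ?thesis .
qed

lemma sobolev_chain_poincare:
  assumes D: "sobolev_chain q D" and j: "j \<le> q" and ab: "a \<le> b"
    and 0: "\<And>i. i < q \<Longrightarrow> D i a = 0"
  shows "integral {a..b} (\<lambda>x. (D j x)\<^sup>2) \<le> (b - a) ^ (2 * (q - j)) * integral {a..b} (\<lambda>x. (D q x)\<^sup>2)"
  using j
proof (induction rule: inc_induct)
  case (step n)
  have "integral {a..b} (\<lambda>x. (D n x)\<^sup>2) \<le> (b - a)\<^sup>2 * integral {a..b} (\<lambda>x. (D (Suc n) x)\<^sup>2)"
    by (rule sobolev_chain_poincare_step[OF D]) (use step ab 0 in auto)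
  also have "\<dots> \<le> (b - a)\<^sup>2 * ((b - a) ^ (2 * (q - Suc n)) * integral {a..b} (\<lambda>x. (D q x)\<^sup>2))"
    by (intro mult_left_mono step.IH) auto
  also have "\<dots> = (b - a) ^ (2 * (q - n)) * integral {a..b} (\<lambda>x. (D q x)\<^sup>2)"
  proof -
    have "2 * (q - n) = 2 + 2 * (q - Suc n)" using step by simp
    then show ?thesis by (simp only: power_add mult.assoc)
  qed
  finally show ?case .
qed simp

section \<open>Polynomial jets and Hermite interpolation\<close>

lemma higher_pderiv_eq_0:
  fixes p :: "real poly"
  assumes "degree p < n"
  shows "(pderiv ^^ n) p = 0"
proof (rule poly_eqI)
  fix i
  show "coeff ((pderiv ^^ n) p) i = coeff 0 i"
    using assms by (simp add: coeff_higher_pderiv coeff_eq_0)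
qed

lemma higher_pderiv_diff:
  fixes p q :: "real poly"
  shows "(pderiv ^^ n) (p - q) = (pderiv ^^ n) p - (pderiv ^^ n) q"
  by (induction n) (simp_all add: pderiv_diff)

text \<open>The derivative of \<open>(x - b)^(l+1) A\<close> is \<open>(x - b)^l\<close> times
  \<open>(l+1) A + (x - b) A'\<close>, and this cofactor has the value \<open>(l+1) A(b)\<close> at
  \<open>b\<close>; the factors \<open>l+1\<close> build up the factorial.\<close>

lemma jet_power_mult:
  fixes A :: "real poly"
  assumes "j \<le> l"
  shows "poly ((pderiv ^^ j) ([:-b, 1:] ^ l * A)) b = (if j < l then 0 else fact l * poly A b)"
  using assms
proof (induction l arbitrary: j A)
  case (Suc l)
  show ?case
  proof (cases j)
    case 0
    then show ?thesis by simp
  next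
    case (Suc i)
    let ?A = "smult (of_nat (Suc l)) A + [:-b, 1:] * pderiv A"
    have d1: "pderiv [:-b, 1::real:] = 1" by (simp add: pderiv_pCons)
    have "pderiv ([:-b, 1:] ^ Suc l * A) = [:-b, 1:] ^ l * ?A"
      by (simp only: pderiv_mult pderiv_power_Suc d1) (simp add: algebra_simps)
    then have "(pderiv ^^ j) ([:-b, 1:] ^ Suc l * A) = (pderiv ^^ i) ([:-b, 1:] ^ l * ?A)"
      by (simp only: Suc funpow_Suc_right o_apply)
    then show ?thesis using Suc.IH[of i ?A] Suc.prems Suc by simp
  qed
qed simp

text \<open>Orders are matched one at a time: adding a multiple of \<open>(x - b)^l\<close> to
  \<open>R\<close> is invisible to orders below \<open>l\<close> and adjusts order \<open>l\<close>,
  because \<open>A\<close> does not vanish at \<open>b\<close>. The case \<open>A = 1\<close> is the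
  Taylor polynomial.\<close>

lemma jet_exists:
  fixes A :: "real poly"
  assumes "poly A b \<noteq> 0"
  shows "\<exists>R. degree R \<le> l - 1 \<and> (\<forall>j<l. poly ((pderiv ^^ j) (A * R)) b = \<gamma> j)"
proof (induction l)
  case 0
  show ?case by (rule exI[of _ 0]) simp
next
  case (Suc l)
  then obtain R where R: "degree R \<le> l - 1" "\<And>j. j < l \<Longrightarrow> poly ((pderiv ^^ j) (A * R)) b = \<gamma> j"
    by blast
  define s where "s = (\<gamma> l - poly ((pderiv ^^ l) (A * R)) b) / (fact l * poly A b)"
  have eq: "A * (R + smult s ([:-b, 1:] ^ l)) = A * R + smult s ([:-b, 1:] ^ l * A)"
    by (simp add: algebra_simps)
  have "poly ((pderiv ^^ j) (A * (R + smult s ([:-b, 1:] ^ l)))) b = \<gamma> j" if "j < Suc l" for j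
  proof -
    have "poly ((pderiv ^^ j) (A * (R + smult s ([:-b, 1:] ^ l)))) b
        = poly ((pderiv ^^ j) (A * R)) b + s * (if j < l then 0 else fact l * poly A b)"
      unfolding eq using that by (simp add: higher_pderiv_add higher_pderiv_smult jet_power_mult)
    then show ?thesis
      using that R(2)[of j] assms by (cases "j = l") (simp_all add: s_def)
  qed
  moreover have "degree (R + smult s ([:-b, 1:] ^ l)) \<le> l"
    using R(1) by (intro degree_add_le) (auto simp: degree_linear_power intro: order_trans[OF degree_smult_le])
  ultimately show ?case by (intro exI[of _ "R + smult s ([:-b, 1:] ^ l)"]) simp
qed

lemma jet_zero_dvd:
  fixes p :: "real poly"
  assumes "\<And>j. j < l \<Longrightarrow> poly ((pderiv ^^ j) p) b = 0"
  shows "[:-b, 1:] ^ l dvd p"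
  using assms
proof (induction l)
  case (Suc l)
  then obtain A where A: "p = [:-b, 1:] ^ l * A" by (metis dvdE less_Suc_eq)
  have "poly A b = 0"
    using Suc.prems[of l] jet_power_mult[of l l b A] A by simp
  then obtain B where "A = [:-b, 1:] * B" by (metis dvdE poly_eq_0_iff_dvd)
  then have "p = [:-b, 1:] ^ Suc l * B"
    using A by (simp only: power_Suc mult_ac)
  then show ?case by (rule dvdI)
qed simp

text \<open>Roots of multiplicity \<open>k + 1\<close> at two distinct points exceed the degree.
  Since \<open>(x - a)^(k+1)\<close> does not vanish at \<open>b\<close>, the whole multiplicity at
  \<open>b\<close> falls on the cofactor \<open>A\<close>.\<close>

lemma hermite_jets_zero:
  fixes p :: "real poly"
  assumes "a \<noteq> b" "degree p \<le> 2 * k + 1"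
    and "\<And>j. j \<le> k \<Longrightarrow> poly ((pderiv ^^ j) p) a = 0 \<and> poly ((pderiv ^^ j) p) b = 0"
  shows "p = 0"
proof (rule ccontr)
  assume p: "p \<noteq> 0"
  have "[:-a, 1:] ^ Suc k dvd p" "[:-b, 1:] ^ Suc k dvd p"
    using assms(3) by (auto intro!: jet_zero_dvd simp: less_Suc_eq_le simp del: power_Suc)
  then obtain A where A: "p = [:-a, 1:] ^ Suc k * A" and ob: "Suc k \<le> order b p"
    using p order_divides[of b "Suc k" p] by (auto elim: dvdE simp del: power_Suc)
  have "order b ([:-a, 1:] ^ Suc k) = 0"
    using assms(1) by (intro order_0I) (simp add: poly_power)
  then have "order b p = order b A"
    using A p by (simp add: order_mult del: power_Suc)
  moreover have "A \<noteq> 0" using A p by auto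
  ultimately have "Suc k \<le> degree A" using ob order_degree[of A b] by simp
  moreover have "degree p = Suc k + degree A"
    using A \<open>A \<noteq> 0\<close> by (simp add: degree_mult_eq degree_linear_power del: power_Suc)
  ultimately show False using assms(2) by simp
qed

text \<open>Newton's construction: the Taylor polynomial at \<open>a\<close> settles the left end,
  and a correction divisible by \<open>(x - a)^(k+1)\<close> settles the right end without
  disturbing the left one.\<close>

lemma hermite_jets_exists:
  assumes "a \<noteq> (b :: real)"
  shows "\<exists>p. degree p \<le> 2 * k + 1 \<and>
    (\<forall>j\<le>k. poly ((pderiv ^^ j) p) a = \<alpha> j \<and> poly ((pderiv ^^ j) p) b = \<beta> j)"
proof -
  obtain T where T: "degree T \<le> k" "\<And>j. j < Suc k \<Longrightarrow> poly ((pderiv ^^ j) T) a = \<alpha> j"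
    using jet_exists[of 1 a "Suc k" \<alpha>] by auto
  let ?A = "[:-a, 1:] ^ Suc k"
  have "poly ?A b \<noteq> 0" using assms by (simp add: poly_power)
  then obtain R where R: "degree R \<le> k"
    "\<And>j. j < Suc k \<Longrightarrow> poly ((pderiv ^^ j) (?A * R)) b = \<beta> j - poly ((pderiv ^^ j) T) b"
    using jet_exists[of ?A b "Suc k" "\<lambda>j. \<beta> j - poly ((pderiv ^^ j) T) b"]
    by (auto simp del: power_Suc)
  have "degree (?A * R) \<le> Suc k + k"
    using degree_mult_le[of ?A R] R(1) by (simp add: degree_linear_power del: power_Suc)
  then have "degree (T + ?A * R) \<le> 2 * k + 1"
    using T(1) by (intro degree_add_le) (auto simp del: power_Suc)
  moreover have "poly ((pderiv ^^ j) (T + ?A * R)) a = \<alpha> j \<and>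
      poly ((pderiv ^^ j) (T + ?A * R)) b = \<beta> j" if "j \<le> k" for j
    using T(2)[of j] R(2)[of j] jet_power_mult[of j "Suc k" a R] that
    by (simp add: higher_pderiv_add del: power_Suc)
  ultimately show ?thesis by blast
qed

lemma hermite_poly_props:
  assumes "a \<noteq> b"
  shows "degree (hermite_poly k a b f) \<le> 2 * k + 1"
    and "j \<le> k \<Longrightarrow> poly ((pderiv ^^ j) (hermite_poly k a b f)) a = (deriv ^^ j) f a"
    and "j \<le> k \<Longrightarrow> poly ((pderiv ^^ j) (hermite_poly k a b f)) b = (deriv ^^ j) f b"
proof -
  let ?P = "\<lambda>p. degree p \<le> 2 * k + 1 \<and>
    (\<forall>j\<le>k. poly ((pderiv ^^ j) p) a = (deriv ^^ j) f a \<and>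
           poly ((pderiv ^^ j) p) b = (deriv ^^ j) f b)"
  have "\<exists>!p. ?P p"
  proof (rule ex_ex1I)
    show "\<exists>p. ?P p" by (rule hermite_jets_exists[OF assms])
    fix p q assume p: "?P p" and q: "?P q"
    have "p - q = 0"
      by (rule hermite_jets_zero[OF assms, where k = k])
        (use p q degree_diff_le[of p "2 * k + 1" q] in \<open>auto simp: higher_pderiv_diff\<close>)
    then show "p = q" by simp
  qed
  then have "?P (hermite_poly k a b f)"
    unfolding hermite_poly_def by (rule theI')
  then show "degree (hermite_poly k a b f) \<le> 2 * k + 1"
    and "j \<le> k \<Longrightarrow> poly ((pderiv ^^ j) (hermite_poly k a b f)) a = (deriv ^^ j) f a"
    and "j \<le> k \<Longrightarrow> poly ((pderiv ^^ j) (hermite_poly k a b f)) b = (deriv ^^ j) f b"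
    by auto
qed

lemma hermite_poly_eqI:
  assumes "a \<noteq> b" "degree p \<le> 2 * k + 1"
    and "\<And>j. j \<le> k \<Longrightarrow> poly ((pderiv ^^ j) p) a = (deriv ^^ j) f a"
    and "\<And>j. j \<le> k \<Longrightarrow> poly ((pderiv ^^ j) p) b = (deriv ^^ j) f b"
  shows "hermite_poly k a b f = p"
proof -
  have "hermite_poly k a b f - p = 0"
    by (rule hermite_jets_zero[OF assms(1), where k = k])
      (use assms hermite_poly_props[OF assms(1), where k = k and f = f]
          degree_diff_le[of "hermite_poly k a b f" "2 * k + 1" p]
        in \<open>auto simp: higher_pderiv_diff\<close>)
  then show ?thesis by simp
qed

text \<open>Subtracting the Taylor polynomial at \<open>a\<close> makes the jet vanish there and
  leaves the top derivative unchanged, so the Poincare estimate applies. For \<open>l = 0\<close>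
  the truncated degree bound \<open>l - 1\<close> would still admit constants, so
  \<open>r = 0\<close> is chosen directly.\<close>

lemma sobolev_chain_taylor:
  assumes W: "sobolev_chain l W" and ab: "a \<le> b"
  shows "\<exists>r. (pderiv ^^ l) r = 0 \<and>
    integral {a..b} (\<lambda>x. (W 0 x - poly r x)\<^sup>2) \<le> (b - a) ^ (2 * l) * integral {a..b} (\<lambda>x. (W l x)\<^sup>2)"
proof (cases "l = 0")
  case False
  obtain r where r: "degree r \<le> l - 1" "\<And>j. j < l \<Longrightarrow> poly ((pderiv ^^ j) r) a = W j a"
    using jet_exists[of 1 a l "\<lambda>j. W j a"] by auto
  have 0: "(pderiv ^^ l) r = 0" using r(1) False by (intro higher_pderiv_eq_0) simp
  have "integral {a..b} (\<lambda>x. (W 0 x - poly ((pderiv ^^ 0) r) x)\<^sup>2)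
      \<le> (b - a) ^ (2 * (l - 0)) * integral {a..b} (\<lambda>x. (W l x - poly ((pderiv ^^ l) r) x)\<^sup>2)"
    by (rule sobolev_chain_poincare[OF sobolev_chain_diff[OF W sobolev_chain_poly] _ ab])
      (use r in auto)
  then show ?thesis using 0 by auto
qed (use ab in \<open>auto intro!: exI[of _ 0]\<close>)

section \<open>Primitives\<close>

text \<open>The signed integral from 0 to \<open>x\<close>: one of the two terms runs over an empty
  or degenerate interval and is 0.\<close>

definition antideriv :: "(real \<Rightarrow> real) \<Rightarrow> real \<Rightarrow> real" where
  "antideriv f x = integral {0..x} f - integral {x..0} f"

lemma antideriv_diff:
  assumes "\<And>a b. f integrable_on {a..b}" "a \<le> b"
  shows "antideriv f b - antideriv f a = integral {a..b} f"
proof -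
  note comb = Henstock_Kurzweil_Integration.integral_combine[of _ _ _ f, OF _ _ assms(1)]
  have triv: "integral {x..0} f = 0" if "0 \<le> x" for x
    using that by (cases "x = 0") auto
  have triv': "integral {0..x} f = 0" if "x \<le> 0" for x
    using that by (cases "x = 0") auto
  consider "0 \<le> a" | "a \<le> 0" "0 \<le> b" | "b \<le> 0" using assms(2) by linarith
  then show ?thesis
  proof cases
    case 1
    then show ?thesis
      using comb[of 0 a b] assms(2) triv[of a] triv[of b] by (simp add: antideriv_def)
  next
    case 2
    then show ?thesis
      using comb[of a 0 b] triv[of b] triv'[of a] by (simp add: antideriv_def)
  next
    case 3
    then show ?thesis
      using comb[of a b 0] assms(2) triv'[of a] triv'[of b] by (simp add: antideriv_def)
  qed
qed

lemma antideriv_0 [simp]: "antideriv f 0 = 0"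
  by (simp add: antideriv_def)

lemma antideriv_has_derivative:
  assumes "continuous_on UNIV f"
  shows "(antideriv f has_real_derivative f x) (at x)"
  using assms
  by (intro integral_difference_has_derivative antideriv_diff locally_L2_integrable
      locally_L2_continuous)

lemma antideriv_continuous: "continuous_on UNIV f \<Longrightarrow> continuous_on UNIV (antideriv f)"
  by (meson DERIV_isCont antideriv_has_derivative continuous_at_imp_continuous_on)

lemma antideriv_period:
  assumes "periodic f" "\<And>a b. f integrable_on {a..b}"
  shows "antideriv f (x + 2 * pi) = antideriv f x + integral {-pi..pi} f"
  using antideriv_diff[OF assms(2), of x "x + 2 * pi"] integral_period[OF assms, of x] by simp

section \<open>D'Alembert's formula\<close>

text \<open>With \<open>f = \<partial>\<^sub>x\<^sup>j\<^sup>+\<^sup>1 u(0)\<close> and \<open>g = \<partial>\<^sub>x\<^sup>j v(0)\<close> these are \<open>\<partial>\<^sub>x\<^sup>j\<^sup>+\<^sup>1 u(t)\<close> and \<open>\<partial>\<^sub>x\<^sup>j v(t)\<close>; only \<open>u(t)\<close>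
  itself involves a primitive of \<open>v(0)\<close>, as second argument of \<open>wave_u\<close>.\<close>

definition wave_u :: "real \<Rightarrow> real \<Rightarrow> (real \<Rightarrow> real) \<Rightarrow> (real \<Rightarrow> real) \<Rightarrow> real \<Rightarrow> real" where
  "wave_u c t f g x = (f (x + c * t) + f (x - c * t)) / 2 + (g (x + c * t) - g (x - c * t)) / (2 * c)"

definition wave_v :: "real \<Rightarrow> real \<Rightarrow> (real \<Rightarrow> real) \<Rightarrow> (real \<Rightarrow> real) \<Rightarrow> real \<Rightarrow> real" where
  "wave_v c t f g x = c * (f (x + c * t) - f (x - c * t)) / 2 + (g (x + c * t) + g (x - c * t)) / 2"

lemma wave_u_0 [simp]: "wave_u c 0 f g = f" and wave_v_0 [simp]: "wave_v c 0 f g = g"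
  by (auto simp: wave_u_def wave_v_def)

text \<open>The terms at the mixed arguments \<open>x + c s - c t\<close> and
  \<open>x - c s + c t\<close> cancel, so that only the two outer characteristics remain.\<close>

lemma wave_u_wave:
  assumes "c \<noteq> 0"
  shows "wave_u c s (wave_u c t f g) (wave_v c t f g) = wave_u c (t + s) f g"
proof
  fix x
  have 1: "x + c * s + c * t = x + c * (t + s)" "x - c * s - c * t = x - c * (t + s)"
    "x + c * s - c * t = x - c * t + c * s" "x - c * s + c * t = x + c * t - c * s"
    by (simp_all add: algebra_simps)
  show "wave_u c s (wave_u c t f g) (wave_v c t f g) x = wave_u c (t + s) f g x"
    unfolding wave_u_def wave_v_def 1 using assms by (simp add: field_simps)
qed

lemma wave_v_wave:
  assumes "c \<noteq> 0"
  shows "wave_v c s (wave_u c t f g) (wave_v c t f g) = wave_v c (t + s) f g"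
proof
  fix x
  have 1: "x + c * s + c * t = x + c * (t + s)" "x - c * s - c * t = x - c * (t + s)"
    "x + c * s - c * t = x - c * t + c * s" "x - c * s + c * t = x + c * t - c * s"
    by (simp_all add: algebra_simps)
  show "wave_v c s (wave_u c t f g) (wave_v c t f g) x = wave_v c (t + s) f g x"
    unfolding wave_u_def wave_v_def 1 using assms by (simp add: field_simps)
qed

lemma wave_u_diff:
  "wave_u c t f g x - wave_u c t f' g' x = wave_u c t (\<lambda>x. f x - f' x) (\<lambda>x. g x - g' x) x"
  by (simp add: wave_u_def diff_divide_distrib add_divide_distrib)

lemma wave_v_diff:
  "wave_v c t f g x - wave_v c t f' g' x = wave_v c t (\<lambda>x. f x - f' x) (\<lambda>x. g x - g' x) x"
  by (simp add: wave_v_def diff_divide_distrib add_divide_distrib algebra_simps)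

lemma locally_L2_wave_u [intro]: "locally_L2 f \<Longrightarrow> locally_L2 g \<Longrightarrow> locally_L2 (wave_u c t f g)"
  unfolding wave_u_def
  by (intro locally_L2_add locally_L2_diff locally_L2_divide locally_L2_shift locally_L2_shift_minus)

lemma locally_L2_wave_v [intro]: "locally_L2 f \<Longrightarrow> locally_L2 g \<Longrightarrow> locally_L2 (wave_v c t f g)"
  unfolding wave_v_def
  by (intro locally_L2_add locally_L2_diff locally_L2_divide locally_L2_cmult locally_L2_shift
      locally_L2_shift_minus)

text \<open>\<open>g\<close> may be a primitive of a velocity with nonzero mean, which grows by a
  fixed \<open>d\<close> per period; the increments cancel in the difference of its two
  values.\<close>

lemma periodic_wave_u:
  assumes "periodic f" "\<And>x. g (x + 2 * pi) = g x + d"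
  shows "periodic (wave_u c t f g)"
  unfolding periodic_def
proof
  fix x
  have 1: "x + 2 * pi + c * t = x + c * t + 2 * pi" "x + 2 * pi - c * t = x - c * t + 2 * pi" by simp_all
  show "wave_u c t f g (x + 2 * pi) = wave_u c t f g x"
    unfolding wave_u_def 1 assms(2) using assms(1) by (simp add: periodic_def)
qed

lemma periodic_wave_v:
  assumes "periodic f" "periodic g"
  shows "periodic (wave_v c t f g)"
  unfolding periodic_def
proof
  fix x
  have 1: "x + 2 * pi + c * t = x + c * t + 2 * pi" "x + 2 * pi - c * t = x - c * t + 2 * pi" by simp_all
  show "wave_v c t f g (x + 2 * pi) = wave_v c t f g x"
    unfolding wave_v_def 1 using assms by (simp add: periodic_def)
qed

lemma wave_solution_dalembert:
  assumes c: "0 < c" and f: "\<And>x. (f has_real_derivative f' x) (at x)" "continuous_on UNIV f'"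
    and g: "continuous_on UNIV g" and per: "periodic f" "periodic f'" "periodic g"
  shows "wave_solution c (\<lambda>t. wave_u c t f (antideriv g)) (\<lambda>t. wave_v c t f' g)"
proof -
  define G where "G = antideriv g"
  define F where "F = antideriv f"
  define H where "H = antideriv G"
  have cf: "continuous_on UNIV f" using f(1) by (meson DERIV_isCont continuous_at_imp_continuous_on)
  have G: "(G has_real_derivative g x) (at x)" for x
    unfolding G_def by (rule antideriv_has_derivative[OF g])
  have F: "(F has_real_derivative f x) (at x)" for x
    unfolding F_def by (rule antideriv_has_derivative[OF cf])
  have cG: "continuous_on UNIV G" unfolding G_def by (rule antideriv_continuous[OF g])
  have H: "(H has_real_derivative G x) (at x)" for x
    unfolding H_def by (rule antideriv_has_derivative[OF cG])
  note der = f(1) F G H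
  note der_chain = der[THEN DERIV_chain2]
  have comp: "continuous_on A (\<lambda>z. h (k z))" if "continuous_on UNIV h" "continuous_on A k"
    for h k :: "_ \<Rightarrow> real" and A :: "(real \<times> real) set"
    using continuous_on_compose2[OF that(1,2)] by simp
  have ftc: "integral {0..t} (\<lambda>s. h' s) = h t - h 0"
    if "0 \<le> t" "\<And>s. (h has_real_derivative h' s) (at s)" for h h' :: "real \<Rightarrow> real" and t
    by (rule integral_unique[OF fundamental_theorem_of_calculus[OF that(1)]])
      (use that(2) in \<open>simp add: has_real_derivative_iff_has_vector_derivative[symmetric]
          has_field_derivative_at_within\<close>)
  show ?thesis
    unfolding wave_solution_def G_def[symmetric]
  proof (intro conjI allI impI)
    show "continuous_on ({0..} \<times> UNIV) (\<lambda>(t, x). wave_u c t f G x)"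
      unfolding wave_u_def case_prod_unfold
      using c by (intro continuous_intros comp[OF cf] comp[OF cG]) auto
    show "continuous_on ({0..} \<times> UNIV) (\<lambda>(t, x). wave_v c t f' g x)"
      unfolding wave_v_def case_prod_unfold
      using c by (intro continuous_intros comp[OF f(2)] comp[OF g]) auto
  next
    fix t :: real
    show "periodic (wave_u c t f G)"
    proof (rule periodic_wave_u[OF per(1)])
      show "G (x + 2 * pi) = G x + integral {-pi..pi} g" for x
        unfolding G_def
        by (intro antideriv_period per(3) locally_L2_integrable locally_L2_continuous g)
    qed
    show "periodic (wave_v c t f' g)" by (rule periodic_wave_v[OF per(2,3)])
  next
    fix t x :: real assume t: "0 \<le> t"
    have "((\<lambda>s. wave_u c s f G x) has_real_derivative wave_v c s f' g x) (at s)" for s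
      unfolding wave_u_def wave_v_def
      by (rule derivative_eq_intros der_chain refl | use c in \<open>simp add: field_simps\<close>)+
    from ftc[OF t this] show "wave_u c t f G x = wave_u c 0 f G x + integral {0..t} (\<lambda>s. wave_v c s f' g x)"
      by simp
  next
    fix t :: real assume t: "0 \<le> t"
    \<comment> \<open>The closed form of the time integral of \<open>u\<close>, as a function of two
      primitives. Each space derivative lowers both by one level, from \<open>(F, H)\<close> to
      \<open>(f, G)\<close> to \<open>(f', g)\<close>, so no second derivative of \<open>f\<close>
      is formed.\<close>
    let ?W = "\<lambda>f G t x. (f (x + c * t) - f (x - c * t)) / (2 * c)
      + (G (x + c * t) + G (x - c * t) - 2 * G x) / (2 * c\<^sup>2)"
    have "((\<lambda>s. ?W F H s x) has_real_derivative wave_u c s f G x) (at s)" for s x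
      unfolding wave_u_def
      by (rule derivative_eq_intros der_chain refl | use c in \<open>simp add: field_simps power2_eq_square\<close>)+
    from ftc[OF t this] have W: "(\<lambda>y. integral {0..t} (\<lambda>s. wave_u c s f G y)) = ?W F H t"
      by auto
    have "(?W F H t has_real_derivative ?W f G t x) (at x)" for x
      by (rule derivative_eq_intros der_chain refl | use c in \<open>simp add: field_simps\<close>)+
    moreover have "(?W f G t has_real_derivative ?W f' g t x) (at x)" for x
      by (rule derivative_eq_intros der_chain refl | use c in \<open>simp add: field_simps\<close>)+
    moreover have "wave_v c t f' g x = wave_v c 0 f' g x + c\<^sup>2 * ?W f' g t x" for x
      using c by (simp add: wave_v_def field_simps power2_eq_square)
    ultimately show "\<exists>W' W''. \<forall>x.
        ((\<lambda>y. integral {0..t} (\<lambda>s. wave_u c s f G y)) has_real_derivative W' x) (at x) \<and>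
        (W' has_real_derivative W'' x) (at x) \<and>
        wave_v c t f' g x = wave_v c 0 f' g x + c\<^sup>2 * W'' x"
      unfolding W by (intro exI[of _ "?W f G t"] exI[of _ "?W f' g t"] allI conjI)
  qed
qed

section \<open>Uniqueness of solutions\<close>

text \<open>Only one partial derivative has to be continuous; the other need only exist at the
  point. In the uniqueness proof the continuous one is always \<open>u\<close>: the space derivative
  of \<open>antideriv (u t)\<close> and the time derivative of \<open>W\<close>. Nothing is known
  about joint continuity of \<open>Wx\<close>.\<close>

lemma has_derivative_along_path:
  fixes F :: "real \<Rightarrow> real \<Rightarrow> real"
  assumes Fx: "((\<lambda>x. F x (\<beta> t)) has_real_derivative Fx) (at (\<alpha> t) within X)"
    and Fy: "\<And>x y. x \<in> X \<Longrightarrow> y \<in> Y \<Longrightarrow> ((\<lambda>y. F x y) has_real_derivative Fy x y) (at y within Y)"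
    and cont: "continuous_on (X \<times> Y) (\<lambda>(x, y). Fy x y)" and Y: "convex Y"
    and \<alpha>: "(\<alpha> has_real_derivative \<alpha>') (at t within S)"
    and \<beta>: "(\<beta> has_real_derivative \<beta>') (at t within S)"
    and sub: "\<alpha> ` S \<subseteq> X" "\<beta> ` S \<subseteq> Y" and t: "t \<in> S"
  shows "((\<lambda>t. F (\<alpha> t) (\<beta> t)) has_real_derivative Fx * \<alpha>' + Fy (\<alpha> t) (\<beta> t) * \<beta>') (at t within S)"
proof -
  have mem: "\<alpha> t \<in> X" "\<beta> t \<in> Y" using sub t by auto
  have "((\<lambda>(x, y). F x y) has_derivative
      (\<lambda>(tx, ty). Fx * tx + blinfun_mult_right (Fy (\<alpha> t) (\<beta> t)) ty)) (at (\<alpha> t, \<beta> t) within X \<times> Y)"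
  proof (rule has_derivative_partialsI[where fy = "\<lambda>x y. blinfun_mult_right (Fy x y)"])
    show "((\<lambda>x. F x (\<beta> t)) has_derivative (*) Fx) (at (\<alpha> t) within X)"
      using Fx by (simp add: has_field_derivative_def)
    show "((\<lambda>y. F x y) has_derivative blinfun_mult_right (Fy x y)) (at y within Y)"
      if "x \<in> X" "y \<in> Y" for x y
      using Fy[OF that] by (simp add: has_field_derivative_def)
    have "continuous_on (X \<times> Y) (\<lambda>(x, y). blinfun_mult_right (Fy x y))"
      using bounded_linear.continuous_on[OF bounded_linear_blinfun_mult_right cont]
      by (simp add: case_prod_unfold)
    then show "continuous (at (\<alpha> t, \<beta> t) within X \<times> Y) (\<lambda>(x, y). blinfun_mult_right (Fy x y))"
      using mem by (simp add: continuous_on_eq_continuous_within)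
  qed (use mem Y in auto)
  then have 1: "((\<lambda>(x, y). F x y) has_derivative
      (\<lambda>(tx, ty). Fx * tx + blinfun_mult_right (Fy (\<alpha> t) (\<beta> t)) ty))
      (at (\<alpha> t, \<beta> t) within (\<lambda>t. (\<alpha> t, \<beta> t)) ` S)"
    by (rule has_derivative_subset) (use sub in auto)
  have 2: "((\<lambda>t. (\<alpha> t, \<beta> t)) has_derivative (\<lambda>h. (\<alpha>' * h, \<beta>' * h))) (at t within S)"
    using \<alpha> \<beta> by (intro has_derivative_Pair) (simp_all add: has_field_derivative_def)
  have 3: "(\<lambda>h. Fx * (\<alpha>' * h) + Fy (\<alpha> t) (\<beta> t) * (\<beta>' * h)) = (*) (Fx * \<alpha>' + Fy (\<alpha> t) (\<beta> t) * \<beta>')"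
    by (simp add: fun_eq_iff algebra_simps)
  show ?thesis
    using has_derivative_in_compose[OF 2 1]
    unfolding has_field_derivative_def by (simp only: prod.case blinfun_mult_right.rep_eq 3)
qed

lemma continuous_on_slices:
  fixes g :: "real \<Rightarrow> real \<Rightarrow> real"
  assumes g: "continuous_on ({0..} \<times> UNIV) (\<lambda>(t, x). g t x)"
  shows "S \<subseteq> {0..} \<Longrightarrow> continuous_on S (\<lambda>s. g s x)" and "0 \<le> t \<Longrightarrow> continuous_on UNIV (g t)"
proof -
  assume "S \<subseteq> {0..}"
  then have "continuous_on S ((\<lambda>(t, x). g t x) \<circ> (\<lambda>s. (s, x)))"
    by (intro continuous_on_compose continuous_intros continuous_on_subset[OF g]) auto
  then show "continuous_on S (\<lambda>s. g s x)" by (simp add: o_def)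
next
  assume "0 \<le> t"
  then have "continuous_on UNIV ((\<lambda>(t, x). g t x) \<circ> (\<lambda>x. (t, x)))"
    by (intro continuous_on_compose continuous_intros continuous_on_subset[OF g]) auto
  then show "continuous_on UNIV (g t)" by (simp add: o_def)
qed

text \<open>With \<open>W = \<integral>\<^sub>0\<^sup>t u ds\<close>, the function \<open>Q\<close> below is the standard potential of the wave equation on the
  backward characteristic triangle; it only needs the first derivatives of \<open>W\<close> and is constant.\<close>

lemma wave_solution_zero:
  assumes sol: "wave_solution c u v" and c: "0 < c"
    and 0: "\<And>x. u 0 x = 0" "\<And>x. v 0 x = 0" and t: "0 \<le> t"
  shows "u t x = 0" and "v t x = 0"
proof -
  define W where "W t x = integral {0..t} (\<lambda>s. u s x)" for t x
  have cu: "continuous_on ({0..} \<times> UNIV) (\<lambda>(t, x). u t x)"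
    and cv: "continuous_on ({0..} \<times> UNIV) (\<lambda>(t, x). v t x)"
    and u_int: "\<And>t x. 0 \<le> t \<Longrightarrow> u t x = integral {0..t} (\<lambda>s. v s x)"
    using sol 0 by (auto simp: wave_solution_def)
  have "\<forall>t. \<exists>W' W''. 0 \<le> t \<longrightarrow> (\<forall>x. (W t has_real_derivative W' x) (at x) \<and>
      (W' has_real_derivative W'' x) (at x) \<and> v t x = c\<^sup>2 * W'' x)"
    using sol 0 unfolding wave_solution_def W_def[abs_def] by auto
  then obtain Wx Wxx where
    Wx: "\<And>t x. 0 \<le> t \<Longrightarrow> (W t has_real_derivative Wx t x) (at x)" and
    Wxx: "\<And>t x. 0 \<le> t \<Longrightarrow> (Wx t has_real_derivative Wxx t x) (at x)" and
    v: "\<And>t x. 0 \<le> t \<Longrightarrow> v t x = c\<^sup>2 * Wxx t x"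
    by metis
  note slice_x = continuous_on_slices(2)
  have int_t: "((\<lambda>t. integral {0..t} (\<lambda>s. g s x)) has_real_derivative g t x) (at t within {0..})"
    if "continuous_on ({0..} \<times> UNIV) (\<lambda>(t, x). g t x)" "0 \<le> t"
    for g :: "real \<Rightarrow> real \<Rightarrow> real" and t x
  proof -
    have "continuous_on {0..t + 1} (\<lambda>s. g s x)"
      by (rule continuous_on_slices(1)[OF that(1)]) auto
    then have "((\<lambda>t. integral {0..t} (\<lambda>s. g s x)) has_real_derivative g t x) (at t within {0..t + 1})"
      by (rule integral_has_real_derivative) (use that in auto)
    moreover have "at t within {0..t + 1} = at t within {0..}"
      by (rule at_within_nhd[where S = "{..<t + 1}"]) auto
    ultimately show ?thesis by simp
  qed
  have Wt: "((\<lambda>t. W t x) has_real_derivative u t x) (at t within {0..})" if "0 \<le> t" for t x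
    unfolding W_def by (rule int_t[OF cu that])
  have ut: "((\<lambda>t. u t x) has_real_derivative v t x) (at t within {0..})" if "0 \<le> t" for t x
    by (rule has_field_derivative_transform_within[OF int_t[OF cv that], of 1])
      (use that in \<open>simp_all add: u_int\<close>)
  have int_x: "integral {a..b} (v t) = c\<^sup>2 * (Wx t b - Wx t a)" if "0 \<le> t" "a \<le> b" for t a b
  proof -
    have "((\<lambda>x. c\<^sup>2 * Wxx t x) has_integral c\<^sup>2 * Wx t b - c\<^sup>2 * Wx t a) {a..b}"
      using that(2) by (rule fundamental_theorem_of_calculus)
        (simp add: has_real_derivative_iff_has_vector_derivative[symmetric]
            DERIV_cmult has_field_derivative_at_within Wxx[OF that(1)])
    moreover have "v t = (\<lambda>x. c\<^sup>2 * Wxx t x)" using v[OF that(1)] by auto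
    ultimately have "integral {a..b} (v t) = c\<^sup>2 * Wx t b - c\<^sup>2 * Wx t a"
      by (simp only: integral_unique)
    then show ?thesis by (simp add: right_diff_distrib)
  qed
  have antideriv_v: "antideriv (v t) x = c\<^sup>2 * (Wx t x - Wx t 0)" if "0 \<le> t" for t x
  proof -
    have "antideriv (v t) b - antideriv (v t) a = c\<^sup>2 * (Wx t b - Wx t a)" if "a \<le> b" for a b
      using antideriv_diff[of "v t" a b] slice_x[OF cv \<open>0 \<le> t\<close>] int_x[OF \<open>0 \<le> t\<close>] that
      by (simp add: locally_L2_integrable locally_L2_continuous)
    from this[of 0 x] this[of x 0] show ?thesis
      by (cases "0 \<le> x") (auto simp: algebra_simps)
  qed
  have leib: "((\<lambda>t. integral {a..b} (u t)) has_real_derivative integral {a..b} (v t)) (at t within {0..})"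
    if "0 \<le> t" for t a b
  proof -
    have "((\<lambda>t. integral (cbox a b) (u t)) has_real_derivative integral (cbox a b) (v t))
        (at t within {0..})"
    proof (rule leibniz_rule_field_derivative)
      show "continuous_on ({0..} \<times> cbox a b) (\<lambda>(t, x). v t x)"
        using cv by (rule continuous_on_subset) auto
      show "u t integrable_on cbox a b" if "t \<in> {0..}" for t
        using slice_x[OF cu] that by (simp add: locally_L2_integrable locally_L2_continuous)
    qed (use that ut in auto)
    then show ?thesis by simp
  qed
  have At: "((\<lambda>t. antideriv (u t) x) has_real_derivative c\<^sup>2 * (Wx t x - Wx t 0)) (at t within {0..})"
    if "0 \<le> t" for t x
    unfolding antideriv_v[OF that, symmetric]
    unfolding antideriv_def by (intro DERIV_diff leib that)
  have W0: "W T x = 0" if T: "0 \<le> T" for T x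
  proof -
    define Q where "Q t = antideriv (u t) (x + c * (T - t)) - antideriv (u t) (x - c * (T - t))
      + c * (W t (x + c * (T - t)) + W t (x - c * (T - t)))" for t
    have A_path: "((\<lambda>t. antideriv (u t) (\<beta> t)) has_real_derivative
        c\<^sup>2 * (Wx t (\<beta> t) - Wx t 0) + u t (\<beta> t) * \<beta>') (at t within {0..})"
      if "0 \<le> t" "(\<beta> has_real_derivative \<beta>') (at t within {0..})" for \<beta> \<beta>' t
      using has_derivative_along_path[of "\<lambda>t. antideriv (u t)" \<beta> t _ "\<lambda>t. t" "{0..}" UNIV u 1 "{0..}" \<beta>',
          OF At[OF that(1)] _ cu _ _ that(2)]
        antideriv_has_derivative slice_x[OF cu] that(1) by simp
    have W_path: "((\<lambda>t. W t (\<beta> t)) has_real_derivative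
        Wx t (\<beta> t) * \<beta>' + u t (\<beta> t)) (at t within {0..})"
      if "0 \<le> t" "(\<beta> has_real_derivative \<beta>') (at t within {0..})" for \<beta> \<beta>' t
    proof -
      have "continuous_on (UNIV \<times> {0..}) ((\<lambda>(t, x). u t x) \<circ> (\<lambda>p. (snd p, fst p)))"
        by (intro continuous_on_compose continuous_intros continuous_on_subset[OF cu]) auto
      then have "continuous_on (UNIV \<times> {0..}) (\<lambda>(x, t). u t x)"
        by (simp add: o_def case_prod_unfold)
      then show ?thesis
        using has_derivative_along_path[of "\<lambda>x t. W t x" "\<lambda>t. t" t _ \<beta> UNIV "{0..}" "\<lambda>x t. u t x" \<beta>' "{0..}" 1,
            OF Wx[OF that(1)] _ _ _ that(2)] Wt that(1) by simp
    qed
    \<comment> \<open>The term \<open>Wx t 0\<close>, produced by the base point of the primitives,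
      cancels in their difference; the remaining terms cancel because the endpoints move with speed
      \<open>c\<close>.\<close>
    have "(Q has_real_derivative 0) (at t within {0..})" if "0 \<le> t" for t
    proof -
      have b: "((\<lambda>t. x + c * (T - t)) has_real_derivative - c) (at t within {0..})"
        "((\<lambda>t. x - c * (T - t)) has_real_derivative c) (at t within {0..})"
        by (auto intro!: derivative_eq_intros)
      show ?thesis
        unfolding Q_def
        by (rule DERIV_cong[OF DERIV_add[OF DERIV_diff[OF A_path[OF that b(1)] A_path[OF that b(2)]]
              DERIV_cmult[OF DERIV_add[OF W_path[OF that b(1)] W_path[OF that b(2)]]]]])
          (simp add: algebra_simps power2_eq_square)
    qed
    then obtain k where "\<forall>t\<in>{0..}. Q t = k"
      using has_field_derivative_zero_constant[of "{0..}" Q] by auto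
    \<comment> \<open>At time \<open>T\<close> both endpoints meet at \<open>x\<close>, which leaves
      \<open>2 * c * W T x\<close>; at time 0 both \<open>u\<close> and \<open>W\<close>
      vanish.\<close>
    then have "Q T = Q 0" using T by simp
    moreover have "u 0 = (\<lambda>_. 0)" using 0(1) by auto
    then have "antideriv (u 0) y = 0" for y by (simp add: antideriv_def)
    ultimately have "2 * c * W T x = 0" by (simp add: Q_def W_def)
    then show ?thesis using c by simp
  qed
  have v0: "v t x = 0" if "0 \<le> t" for t x
  proof -
    have "W t = (\<lambda>_. 0)" using W0[OF that] by auto
    then have "Wx t x = 0" for x using Wx[OF that, of x] DERIV_unique[OF _ DERIV_const] by metis
    then have "Wx t = (\<lambda>_. 0)" by auto
    then have "Wxx t x = 0" using Wxx[OF that, of x] DERIV_unique[OF _ DERIV_const] by metis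
    then show ?thesis using v[OF that] by simp
  qed
  show "v t x = 0" by (rule v0[OF t])
  have "integral {0..t} (\<lambda>s. v s x) = integral {0..t} (\<lambda>s. 0)"
    by (rule integral_cong) (use v0 in auto)
  then show "u t x = 0" using u_int[OF t] by simp
qed

section \<open>From uniqueness to the solution operator\<close>

lemma wave_solution_diff:
  assumes "wave_solution c u v" "wave_solution c u' v'"
  shows "wave_solution c (\<lambda>t x. u t x - u' t x) (\<lambda>t x. v t x - v' t x)"
proof -
  have int: "(\<lambda>s. g s x) integrable_on {0..t}"
    if "continuous_on ({0..} \<times> UNIV) (\<lambda>(t, x). g t x)" for g :: "real \<Rightarrow> real \<Rightarrow> real" and t x
    by (intro integrable_continuous_real continuous_on_slices(1)[OF that]) auto
  note cont = assms[unfolded wave_solution_def, THEN conjunct1]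
    assms[unfolded wave_solution_def, THEN conjunct2, THEN conjunct1]
  note per = assms[unfolded wave_solution_def, THEN conjunct2, THEN conjunct2, THEN conjunct1]
  note u_int = assms[unfolded wave_solution_def, THEN conjunct2, THEN conjunct2, THEN conjunct2,
      THEN conjunct1]
  note W_ex = assms[unfolded wave_solution_def, THEN conjunct2, THEN conjunct2, THEN conjunct2,
      THEN conjunct2]
  show ?thesis
    unfolding wave_solution_def
  proof (intro conjI allI impI)
    show "continuous_on ({0..} \<times> UNIV) (\<lambda>(t, x). u t x - u' t x)"
      "continuous_on ({0..} \<times> UNIV) (\<lambda>(t, x). v t x - v' t x)"
      using continuous_on_diff[OF cont(1,2)] continuous_on_diff[OF cont(3,4)]
      by (simp_all add: case_prod_unfold)
  next
    fix t :: real assume t: "0 \<le> t"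
    show "periodic (\<lambda>x. u t x - u' t x)" "periodic (\<lambda>x. v t x - v' t x)"
      using per t by (simp_all add: periodic_def)
  next
    fix t x :: real assume t: "0 \<le> t"
    show "u t x - u' t x = u 0 x - u' 0 x + integral {0..t} (\<lambda>s. v s x - v' s x)"
      using u_int[THEN spec, THEN mp[OF _ t], THEN spec, of x]
        integral_diff[OF int[OF cont(3), of x t] int[OF cont(4), of x t]] by linarith
  next
    fix t :: real assume t: "0 \<le> t"
    obtain W' W'' where W: "\<And>x. ((\<lambda>y. integral {0..t} (\<lambda>s. u s y)) has_real_derivative W' x) (at x)"
        "\<And>x. (W' has_real_derivative W'' x) (at x)" "\<And>x. v t x = v 0 x + c\<^sup>2 * W'' x"
      using W_ex(1)[rule_format, OF t] by blast
    obtain V' V'' where V: "\<And>x. ((\<lambda>y. integral {0..t} (\<lambda>s. u' s y)) has_real_derivative V' x) (at x)"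
        "\<And>x. (V' has_real_derivative V'' x) (at x)" "\<And>x. v' t x = v' 0 x + c\<^sup>2 * V'' x"
      using W_ex(2)[rule_format, OF t] by blast
    have "(\<lambda>y. integral {0..t} (\<lambda>s. u s y - u' s y))
        = (\<lambda>y. integral {0..t} (\<lambda>s. u s y) - integral {0..t} (\<lambda>s. u' s y))"
      using integral_diff[OF int[OF cont(1)] int[OF cont(2)]] by auto
    then show "\<exists>W' W''. \<forall>x.
        ((\<lambda>y. integral {0..t} (\<lambda>s. u s y - u' s y)) has_real_derivative W' x) (at x) \<and>
        (W' has_real_derivative W'' x) (at x) \<and>
        v t x - v' t x = v 0 x - v' 0 x + c\<^sup>2 * W'' x"
      by (intro exI[of _ "\<lambda>x. W' x - V' x"] exI[of _ "\<lambda>x. W'' x - V'' x"] allI conjI)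
        (simp_all only: DERIV_diff[OF W(1) V(1)] DERIV_diff[OF W(2) V(2)] W(3)[of x for x] V(3)[of x for x]
          right_diff_distrib algebra_simps)
  qed
qed

lemma wave_solution_unique:
  assumes "wave_solution c u v" "wave_solution c u' v'" "0 < c" "u 0 = u' 0" "v 0 = v' 0" "0 \<le> t"
  shows "u t = u' t" "v t = v' t"
  using wave_solution_zero[OF wave_solution_diff[OF assms(1,2)] assms(3) _ _ assms(6)] assms(4,5)
  by (auto simp: fun_eq_iff)

lemma wave_evolution_eq:
  assumes "wave_solution c u v" "0 < c" "0 \<le> t"
  shows "wave_evolution c t (u 0, v 0) = (u t, v t)"
  unfolding wave_evolution_def
proof (rule the_equality)
  show "\<exists>u' v'. wave_solution c u' v' \<and> (u' 0, v' 0) = (u 0, v 0) \<and> (u t, v t) = (u' t, v' t)"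
    using assms(1) by blast
  fix z assume "\<exists>u' v'. wave_solution c u' v' \<and> (u' 0, v' 0) = (u 0, v 0) \<and> z = (u' t, v' t)"
  then obtain u' v' where "wave_solution c u' v'" "u' 0 = u 0" "v' 0 = v 0" "z = (u' t, v' t)" by auto
  then show "z = (u t, v t)" using wave_solution_unique[OF _ assms(1,2) _ _ assms(3)] by auto
qed

section \<open>Periodic chains and their evolution\<close>

definition periodic_chain :: "nat \<Rightarrow> (nat \<Rightarrow> real \<Rightarrow> real) \<Rightarrow> bool" where
  "periodic_chain q D \<longleftrightarrow> sobolev_chain q D \<and> (\<forall>j\<le>q. periodic (D j))"

lemma periodic_chain_L2: "periodic_chain q D \<Longrightarrow> j \<le> q \<Longrightarrow> locally_L2 (D j)"
  by (auto simp: periodic_chain_def intro: sobolev_chain_L2)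

lemma periodic_chain_periodic: "periodic_chain q D \<Longrightarrow> j \<le> q \<Longrightarrow> periodic (D j)"
  by (simp add: periodic_chain_def)

lemma periodic_chain_mono: "periodic_chain q D \<Longrightarrow> r \<le> q \<Longrightarrow> periodic_chain r D"
  by (auto simp: periodic_chain_def intro: sobolev_chain_mono)

text \<open>The chain is built after the choice made by \<open>SOME\<close>, so its top entry is the
  very representative whose norm appears in the final estimate.\<close>

lemma sobolev_deriv_chain:
  assumes "f \<in> H_per q"
  shows "\<exists>D. periodic_chain q D \<and> D 0 = f \<and> D q = sobolev_deriv q f"
proof -
  obtain w where "has_sobolev_deriv q f w" using assms by (auto simp: H_per_def)
  then have "has_sobolev_deriv q f (sobolev_deriv q f)"
    unfolding sobolev_deriv_def by (rule someI[of "has_sobolev_deriv q f"])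
  then show ?thesis by (auto simp: has_sobolev_deriv_iff_chain periodic_chain_def)
qed

lemma sobolev_chain_wave_u:
  assumes "sobolev_chain q D" "sobolev_chain q E"
  shows "sobolev_chain q (\<lambda>j. wave_u c t (D j) (E j))"
  unfolding wave_u_def
  by (intro sobolev_chain_add sobolev_chain_divide sobolev_chain_diff sobolev_chain_shift
      sobolev_chain_shift_minus assms)

lemma sobolev_chain_wave_v:
  assumes "sobolev_chain q D" "sobolev_chain q E"
  shows "sobolev_chain q (\<lambda>j. wave_v c t (D j) (E j))"
  unfolding wave_v_def
  by (intro sobolev_chain_add sobolev_chain_divide sobolev_chain_diff sobolev_chain_cmult
      sobolev_chain_shift sobolev_chain_shift_minus assms)

lemma sobolev_chain_primitive:
  assumes "sobolev_chain q D"
  shows "sobolev_chain (Suc q) (case_nat (antideriv (D 0)) D)"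
proof -
  have int: "D 0 integrable_on {a..b}" for a b
    using assms by (intro locally_L2_integrable sobolev_chain_L2) auto
  have diff: "antideriv (D 0) b - antideriv (D 0) a = integral {a..b} (D 0)" if "a \<le> b" for a b
    using antideriv_diff[OF int that] .
  have "continuous_on UNIV (antideriv (D 0))"
    by (rule integral_difference_continuous[OF diff int])
  then show ?thesis
    using assms diff
    by (auto simp: sobolev_chain_def intro: locally_L2_continuous split: nat.splits)
qed

text \<open>Order \<open>j\<close> of \<open>u\<close> is coupled to order \<open>j - 1\<close> of
  \<open>v\<close>; hence the velocity chain is shifted by one, with its primitive in front.\<close>

definition wave_chain_u ::
    "real \<Rightarrow> real \<Rightarrow> (nat \<Rightarrow> real \<Rightarrow> real) \<Rightarrow> (nat \<Rightarrow> real \<Rightarrow> real) \<Rightarrow> nat \<Rightarrow> real \<Rightarrow> real" where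
  "wave_chain_u c t P Q j = wave_u c t (P j) (case_nat (antideriv (Q 0)) Q j)"

definition wave_chain_v ::
    "real \<Rightarrow> real \<Rightarrow> (nat \<Rightarrow> real \<Rightarrow> real) \<Rightarrow> (nat \<Rightarrow> real \<Rightarrow> real) \<Rightarrow> nat \<Rightarrow> real \<Rightarrow> real" where
  "wave_chain_v c t P Q j = wave_v c t (P (Suc j)) (Q j)"

lemma wave_chain_u_Suc [simp]: "wave_chain_u c t P Q (Suc j) = wave_u c t (P (Suc j)) (Q j)"
  by (simp add: wave_chain_u_def)

lemma periodic_chain_wave_u:
  assumes P: "periodic_chain (Suc q) P" and Q: "periodic_chain q Q"
  shows "periodic_chain (Suc q) (wave_chain_u c t P Q)"
  unfolding periodic_chain_def
proof (intro conjI allI impI)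
  show "sobolev_chain (Suc q) (wave_chain_u c t P Q)"
    using sobolev_chain_wave_u[of "Suc q" P "case_nat (antideriv (Q 0)) Q"] sobolev_chain_primitive P Q
    unfolding periodic_chain_def wave_chain_u_def[abs_def] by simp
  fix j assume j: "j \<le> Suc q"
  show "periodic (wave_chain_u c t P Q j)"
  proof (cases j)
    case 0
    show ?thesis
      unfolding 0 wave_chain_u_def
    proof (rule periodic_wave_u[OF periodic_chain_periodic[OF P]])
      show "case_nat (antideriv (Q 0)) Q 0 (x + 2 * pi)
          = case_nat (antideriv (Q 0)) Q 0 x + integral {-pi..pi} (Q 0)" for x
        using antideriv_period[OF periodic_chain_periodic[OF Q]
            locally_L2_integrable[OF periodic_chain_L2[OF Q]]] by simp
    qed simp
  next
    case (Suc i)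
    show ?thesis
      unfolding Suc wave_chain_u_Suc
    proof (rule periodic_wave_u[OF periodic_chain_periodic[OF P]])
      show "Q i (x + 2 * pi) = Q i x + 0" for x
        using periodic_chain_periodic[OF Q, of i] j Suc by (simp add: periodic_def)
    qed (use j Suc in auto)
  qed
qed

lemma periodic_chain_wave_v:
  assumes P: "periodic_chain (Suc q) P" and Q: "periodic_chain q Q"
  shows "periodic_chain q (wave_chain_v c t P Q)"
  unfolding periodic_chain_def
proof (intro conjI allI impI)
  show "sobolev_chain q (wave_chain_v c t P Q)"
    using sobolev_chain_wave_v[of q "\<lambda>j. P (Suc j)" Q] sobolev_chain_Suc P Q
    unfolding periodic_chain_def wave_chain_v_def[abs_def] by simp
  fix j assume "j \<le> q"
  then show "periodic (wave_chain_v c t P Q j)"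
    unfolding wave_chain_v_def
    by (intro periodic_wave_v periodic_chain_periodic[OF P] periodic_chain_periodic[OF Q]) auto
qed

text \<open>With \<open>1 \<le> q\<close> both \<open>P 1\<close> and \<open>Q 0\<close> are
  continuous, which is what d'Alembert's formula asks for. The numerical solution enters with
  \<open>q = m\<close>, the exact one with \<open>q = 2 * m\<close>.\<close>

lemma wave_solution_chain:
  assumes P: "periodic_chain (Suc q) P" and Q: "periodic_chain q Q" and q: "1 \<le> q" and c: "0 < c"
  shows "wave_solution c (\<lambda>t. wave_chain_u c t P Q 0) (\<lambda>t. wave_chain_v c t P Q 0)"
proof -
  have P': "sobolev_chain (Suc q) P" and Q': "sobolev_chain q Q"
    using P Q by (auto simp: periodic_chain_def)
  have "wave_solution c (\<lambda>t. wave_u c t (P 0) (antideriv (Q 0))) (\<lambda>t. wave_v c t (P 1) (Q 0))"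
  proof (rule wave_solution_dalembert[OF c])
    show "(P 0 has_real_derivative P 1 x) (at x)" for x
      using sobolev_chain_has_deriv[OF P', of 0 x] q by simp
  qed (use q in \<open>auto intro: sobolev_chain_continuous[OF P'] sobolev_chain_continuous[OF Q']
      periodic_chain_periodic[OF P] periodic_chain_periodic[OF Q]\<close>)
  then show ?thesis by (simp add: wave_chain_u_def wave_chain_v_def)
qed

lemma wave_evolution_chain:
  assumes "periodic_chain (Suc q) P" "periodic_chain q Q" "1 \<le> q" "0 < c" "0 \<le> t"
  shows "wave_evolution c t (P 0, Q 0) = (wave_chain_u c t P Q 0, wave_chain_v c t P Q 0)"
  using wave_evolution_eq[OF wave_solution_chain[OF assms(1-4)] assms(4,5)]
  by (simp add: wave_chain_u_def wave_chain_v_def)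

section \<open>The energy\<close>

definition wave_inner ::
    "real \<Rightarrow> (real \<Rightarrow> real) \<Rightarrow> (real \<Rightarrow> real) \<Rightarrow> (real \<Rightarrow> real) \<Rightarrow> (real \<Rightarrow> real) \<Rightarrow> real" where
  "wave_inner c f g f' g' =
     c\<^sup>2 * integral {-pi..pi} (\<lambda>x. f x * f' x) + integral {-pi..pi} (\<lambda>x. g x * g' x)"

text \<open>\<open>f\<close> stands for the space derivative of \<open>u\<close>, not for
  \<open>u\<close>, so one functional serves every order of differentiation.\<close>

definition wave_energy :: "real \<Rightarrow> (real \<Rightarrow> real) \<Rightarrow> (real \<Rightarrow> real) \<Rightarrow> real" where
  "wave_energy c f g =
     c\<^sup>2 * integral {-pi..pi} (\<lambda>x. (f x)\<^sup>2) + integral {-pi..pi} (\<lambda>x. (g x)\<^sup>2)"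

lemma integral_square_nonneg: "locally_L2 f \<Longrightarrow> 0 \<le> integral {a..b} (\<lambda>x. (f x)\<^sup>2)"
  by (intro integral_nonneg locally_L2_square_integrable) auto

lemma wave_energy_nonneg: "locally_L2 f \<Longrightarrow> locally_L2 g \<Longrightarrow> 0 \<le> wave_energy c f g"
  by (simp add: wave_energy_def integral_square_nonneg)

section \<open>Cauchy-Schwarz and triangle inequality for the energy\<close>

lemma integral_square_add:
  assumes "locally_L2 f" "locally_L2 f'"
  shows "integral {a..b} (\<lambda>x. (f x + f' x)\<^sup>2) = integral {a..b} (\<lambda>x. (f x)\<^sup>2)
    + 2 * integral {a..b} (\<lambda>x. f x * f' x) + integral {a..b} (\<lambda>x. (f' x)\<^sup>2)"
proof -
  have "((\<lambda>x. (f x)\<^sup>2 + 2 * (f x * f' x) + (f' x)\<^sup>2) has_integral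
      (integral {a..b} (\<lambda>x. (f x)\<^sup>2) + 2 * integral {a..b} (\<lambda>x. f x * f' x)
        + integral {a..b} (\<lambda>x. (f' x)\<^sup>2))) {a..b}"
    using assms
    by (intro has_integral_add has_integral_mult_right integrable_integral
        locally_L2_square_integrable locally_L2_mult_integrable)
  moreover have "(\<lambda>x. (f x)\<^sup>2 + 2 * (f x * f' x) + (f' x)\<^sup>2) = (\<lambda>x. (f x + f' x)\<^sup>2)"
    by (simp add: power2_sum fun_eq_iff)
  ultimately show ?thesis by (simp add: integral_unique)
qed

lemma wave_energy_add:
  assumes "locally_L2 f" "locally_L2 g" "locally_L2 f'" "locally_L2 g'"
  shows "wave_energy c (\<lambda>x. f x + f' x) (\<lambda>x. g x + g' x)
    = wave_energy c f g + 2 * wave_inner c f g f' g' + wave_energy c f' g'"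
  unfolding wave_energy_def wave_inner_def using assms
  by (simp add: integral_square_add distrib_left)

lemma wave_energy_cmult: "wave_energy c (\<lambda>x. s * f x) (\<lambda>x. s * g x) = s\<^sup>2 * wave_energy c f g"
  by (simp add: wave_energy_def power_mult_distrib distrib_left)

lemma wave_inner_cauchy_schwarz:
  assumes "locally_L2 f" "locally_L2 g" "locally_L2 f'" "locally_L2 g'"
  shows "wave_inner c f g f' g' \<le> sqrt (wave_energy c f g) * sqrt (wave_energy c f' g')"
proof -
  let ?a = "wave_energy c f g" and ?b = "wave_inner c f g f' g'" and ?d = "wave_energy c f' g'"
  have nn: "0 \<le> ?a" "0 \<le> ?d" using assms by (auto intro: wave_energy_nonneg)
  have q: "0 \<le> s\<^sup>2 * ?a + 2 * (s * (r * ?b)) + r\<^sup>2 * ?d" for s r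
  proof -
    have "0 \<le> wave_energy c (\<lambda>x. s * f x + r * f' x) (\<lambda>x. s * g x + r * g' x)"
      using assms by (intro wave_energy_nonneg locally_L2_add locally_L2_cmult)
    also have "\<dots> = s\<^sup>2 * ?a + 2 * wave_inner c (\<lambda>x. s * f x) (\<lambda>x. s * g x) (\<lambda>x. r * f' x) (\<lambda>x. r * g' x)
        + r\<^sup>2 * ?d"
      using assms
      by (subst wave_energy_add) (auto simp: wave_energy_cmult)
    also have "wave_inner c (\<lambda>x. s * f x) (\<lambda>x. s * g x) (\<lambda>x. r * f' x) (\<lambda>x. r * g' x) = s * (r * ?b)"
      by (simp add: wave_inner_def mult.assoc mult.left_commute[of _ r] distrib_left)
    finally show ?thesis .
  qed
  have "?b\<^sup>2 \<le> ?a * ?d"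
  proof (cases "?d = 0")
    \<comment> \<open>The form is only semidefinite on functions. With \<open>?d = 0\<close> it is
      affine in \<open>r\<close>; if \<open>?b\<close> were nonzero, the chosen \<open>r\<close>
      would give it the negative value \<open>- ?a - 2\<close>.\<close>
    case True
    have "0 \<le> ?a + 2 * ((- (?a + 1) / ?b) * ?b)" if "?b \<noteq> 0"
      using q[of 1 "- (?a + 1) / ?b"] True by simp
    then have "?b = 0" using nn by (cases "?b = 0") auto
    then show ?thesis using True by simp
  next
    case False
    then have "0 < ?d" using nn by simp
    have "0 \<le> ?d * (?a * ?d - ?b\<^sup>2)"
      using q[of ?d "- ?b"] by (simp add: power2_eq_square algebra_simps)
    then show ?thesis using \<open>0 < ?d\<close> by (simp add: zero_le_mult_iff)
  qed
  then have "\<bar>?b\<bar> \<le> sqrt (?a * ?d)" by (rule real_le_rsqrt[of "\<bar>?b\<bar>", simplified])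
  then show ?thesis by (simp add: real_sqrt_mult)
qed

lemma wave_energy_triangle:
  assumes "locally_L2 f" "locally_L2 g" "locally_L2 f'" "locally_L2 g'"
  shows "sqrt (wave_energy c (\<lambda>x. f x + f' x) (\<lambda>x. g x + g' x))
    \<le> sqrt (wave_energy c f g) + sqrt (wave_energy c f' g')"
proof (rule real_le_lsqrt)
  have nn: "0 \<le> wave_energy c f g" "0 \<le> wave_energy c f' g'"
    using assms by (auto intro: wave_energy_nonneg)
  then show "0 \<le> sqrt (wave_energy c f g) + sqrt (wave_energy c f' g')" by simp
  show "wave_energy c (\<lambda>x. f x + f' x) (\<lambda>x. g x + g' x)
      \<le> (sqrt (wave_energy c f g) + sqrt (wave_energy c f' g'))\<^sup>2"
    using wave_inner_cauchy_schwarz[OF assms, of c] nn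
    by (simp add: wave_energy_add[OF assms] power2_sum)
qed

text \<open>The Riemann invariants \<open>c f \<plusminus> g\<close> are transported along the characteristics, and the energy is
  half the sum of their squared norms.\<close>

lemma wave_energy_wave:
  assumes f: "locally_L2 f" "periodic f" and g: "locally_L2 g" "periodic g" and c: "c \<noteq> 0"
  shows "wave_energy c (wave_u c t f g) (wave_v c t f g) = wave_energy c f g"
proof -
  define p where "p x = c * f x + g x" for x
  define n where "n x = c * f x - g x" for x
  have L: "locally_L2 p" "locally_L2 n"
    unfolding p_def[abs_def] n_def[abs_def]
    using f g by (auto intro!: locally_L2_add locally_L2_diff locally_L2_cmult)
  have per: "periodic (\<lambda>x. (p x)\<^sup>2)" "periodic (\<lambda>x. (n x)\<^sup>2)"
    using f g by (auto simp: periodic_def p_def n_def)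
  have sq: "(\<lambda>x. (p x)\<^sup>2) integrable_on {a..b}" "(\<lambda>x. (n x)\<^sup>2) integrable_on {a..b}" for a b
    using L by (auto intro: locally_L2_square_integrable)
  have half: "wave_energy c F G = (integral {-pi..pi} (\<lambda>x. (P x)\<^sup>2) + integral {-pi..pi} (\<lambda>x. (N x)\<^sup>2)) / 2"
    if "\<And>x. P x = c * F x + G x" "\<And>x. N x = c * F x - G x" "locally_L2 F" "locally_L2 G"
    for F G P N :: "real \<Rightarrow> real"
  proof -
    have N: "N x = c * F x + (-1) * G x" for x using that(2) by simp
    have G: "locally_L2 (\<lambda>x. - G x)" using locally_L2_cmult[OF that(4), of "-1"] by simp
    have "integral {-pi..pi} (\<lambda>x. (P x)\<^sup>2) + integral {-pi..pi} (\<lambda>x. (N x)\<^sup>2)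
      = 2 * (integral {-pi..pi} (\<lambda>x. (c * F x)\<^sup>2) + integral {-pi..pi} (\<lambda>x. (G x)\<^sup>2))"
      unfolding that(1) N
      by (subst (1 2) integral_square_add) (use that(3,4) G in \<open>auto simp: power_mult_distrib\<close>)
    then show ?thesis by (simp add: wave_energy_def power_mult_distrib)
  qed
  have "wave_energy c (wave_u c t f g) (wave_v c t f g)
      = (integral {-pi..pi} (\<lambda>x. (p (x + c * t))\<^sup>2) + integral {-pi..pi} (\<lambda>x. (n (x + - (c * t)))\<^sup>2)) / 2"
    by (rule half) (use f g c in \<open>auto simp: p_def n_def wave_u_def wave_v_def field_simps\<close>)
  also have "\<dots> = (integral {-pi..pi} (\<lambda>x. (p x)\<^sup>2) + integral {-pi..pi} (\<lambda>x. (n x)\<^sup>2)) / 2"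
    by (simp only: integral_period_shift[OF per(1) sq(1)] integral_period_shift[OF per(2) sq(2)])
  also have "\<dots> = wave_energy c f g"
    by (rule half[symmetric]) (use f g in \<open>auto simp: p_def n_def\<close>)
  finally show ?thesis .
qed

section \<open>Piecewise Hermite interpolation\<close>

text \<open>The interpolant together with its piecewise derivatives; the derivative of order \<open>k + 1\<close> takes
  its value at a node from the cell on the right.\<close>

definition hermite_chain :: "nat \<Rightarrow> real \<Rightarrow> nat \<Rightarrow> (real \<Rightarrow> real) \<Rightarrow> nat \<Rightarrow> real \<Rightarrow> real" where
  "hermite_chain nx \<sigma> k f j x =
     (let i = of_int \<lfloor>(x + pi) / mesh_size nx - \<sigma>\<rfloor> + \<sigma>
      in poly ((pderiv ^^ j) (hermite_poly k (grid_node nx i) (grid_node nx (i + 1)) f)) x)"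

lemma hermite_interp_eq_chain: "hermite_interp nx \<sigma> k f = hermite_chain nx \<sigma> k f 0"
  by (simp add: hermite_interp_def hermite_chain_def fun_eq_iff)

text \<open>Valid also where no derivative exists: \<open>deriv\<close> depends only on the set of
  candidate values, which translates with the function.\<close>

lemma deriv_shift: "deriv (\<lambda>x. f (x + s)) x = deriv f (x + s)" for f :: "real \<Rightarrow> real"
  by (simp add: deriv_def DERIV_shift)

lemma higher_deriv_periodic: "periodic f \<Longrightarrow> periodic ((deriv ^^ j) f)"
proof (induction j)
  case (Suc j)
  then show ?case
    using deriv_shift[of "(deriv ^^ j) f" "2 * pi"] by (simp add: periodic_def)
qed simp

lemma higher_pderiv_pcompose_shift:
  fixes p :: "real poly"
  shows "(pderiv ^^ j) (pcompose p [:s, 1:]) = pcompose ((pderiv ^^ j) p) [:s, 1:]"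
  by (induction j) (simp_all add: pderiv_pcompose pderiv_pCons)

text \<open>One offset belongs to one time level. The locale is interpreted afresh at every half
  step, so the alternation of the grids never enters the estimates.\<close>

locale grid =
  fixes nx :: nat and \<sigma> :: real
  assumes nx: "1 \<le> nx"
begin

section \<open>Nodes and cells\<close>

definition h :: real where "h = mesh_size nx"

definition node :: "int \<Rightarrow> real" where "node i = grid_node nx (of_int i + \<sigma>)"

lemma h_pos: "0 < h"
  using nx by (simp add: h_def mesh_size_def)

lemma node_eq: "node i = - pi + (of_int i + \<sigma>) * h"
  by (simp add: node_def grid_node_def h_def)

lemma node_step: "node (i + 1) = node i + h"
  by (simp add: node_eq algebra_simps)

lemma node_less: "node i < node (i + 1)"
  using h_pos by (simp add: node_step)

lemma node_mono: "i \<le> j \<Longrightarrow> node i \<le> node j"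
  using h_pos by (simp add: node_eq mult_right_mono)

lemma node_period: "node (i + int nx) = node i + 2 * pi"
  using nx by (simp add: node_eq h_def mesh_size_def field_simps)

definition cell :: "real \<Rightarrow> int" where "cell x = \<lfloor>(x + pi) / h - \<sigma>\<rfloor>"

lemma cell_eq_iff: "cell x = i \<longleftrightarrow> node i \<le> x \<and> x < node (i + 1)"
  unfolding cell_def floor_eq_iff node_eq using h_pos by (simp add: field_simps)

lemma node_cell: "node (cell x) \<le> x" "x < node (cell x + 1)"
  using cell_eq_iff[of x "cell x"] by auto

text \<open>Lifts statements about one polynomial piece to arbitrary intervals by walking from the
  cell of \<open>a\<close> to the cell of \<open>b\<close>. It is applied to the fundamental theorem
  and to square integrability of the interpolant.\<close>

lemma cells_induct:
  assumes trans: "\<And>a b c. a \<le> b \<Longrightarrow> b \<le> c \<Longrightarrow> R a b \<Longrightarrow> R b c \<Longrightarrow> R a c"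
    and cell: "\<And>i a b. node i \<le> a \<Longrightarrow> a \<le> b \<Longrightarrow> b \<le> node (i + 1) \<Longrightarrow> R a b"
    and ab: "a \<le> b"
  shows "R a b"
proof -
  define i where "i = cell a"
  have i: "node i \<le> a" "a < node (i + 1)" using node_cell by (auto simp: i_def)
  have *: "R a b" if "a \<le> b" "b \<le> node (i + 1 + int n)" for n b
    using that
  proof (induction n arbitrary: b)
    case 0
    then show ?case using cell[of i a b] i by simp
  next
    case (Suc n)
    let ?z = "node (i + 1 + int n)"
    have z: "a \<le> ?z" using i(2) node_mono[of "i + 1" "i + 1 + int n"] by simp
    show ?case
    proof (cases "b \<le> ?z")
      case True
      then show ?thesis using Suc by simp
    next
      case False
      have "R ?z b"
        by (rule cell[of "i + 1 + int n"]) (use False Suc.prems in \<open>auto simp: add_ac\<close>)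
      moreover have "R a ?z" using Suc.IH[OF z] by simp
      ultimately show ?thesis using trans[OF z] False by auto
    qed
  qed
  have "cell a \<le> cell b"
    unfolding cell_def using ab h_pos by (intro floor_mono) (simp add: divide_right_mono)
  then have "b \<le> node (i + 1 + int (nat (cell b - cell a)))"
    using node_cell(2)[of b] by (simp add: i_def add_ac)
  then show ?thesis by (rule *[OF ab])
qed

text \<open>The \<open>nx\<close> cells starting at \<open>node 0\<close> tile one full period, but
  on the dual grid not \<open>[-pi, pi]\<close>; periodicity of the integrand moves the
  window.\<close>

lemma integral_cells:
  fixes g :: "real \<Rightarrow> real"
  assumes "periodic g" "\<And>a b. g integrable_on {a..b}"
  shows "integral {-pi..pi} g = (\<Sum>i<nx. integral {node (int i)..node (int i + 1)} g)"
proof -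
  have "integral {node 0..node (int n)} g = (\<Sum>i<n. integral {node (int i)..node (int i + 1)} g)" for n
  proof (induction n)
    case (Suc n)
    have "integral {node 0..node (int n)} g + integral {node (int n)..node (int (Suc n))} g
        = integral {node 0..node (int (Suc n))} g"
      by (rule Henstock_Kurzweil_Integration.integral_combine[OF _ _ assms(2)]) (auto intro: node_mono)
    then show ?case using Suc by (simp add: add.commute)
  qed simp
  from this[of nx] show ?thesis
    using integral_period[OF assms, of "node 0"] node_period[of 0] by simp
qed

section \<open>The piecewise interpolant as a periodic chain\<close>

definition cell_poly :: "nat \<Rightarrow> (real \<Rightarrow> real) \<Rightarrow> int \<Rightarrow> real poly" where
  "cell_poly k f i = hermite_poly k (node i) (node (i + 1)) f"

lemma hermite_chain_eq: "hermite_chain nx \<sigma> k f j x = poly ((pderiv ^^ j) (cell_poly k f (cell x))) x"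
  by (simp add: hermite_chain_def cell_poly_def cell_def node_def h_def Let_def add_ac)

lemma cell_poly_props:
  shows "degree (cell_poly k f i) \<le> 2 * k + 1"
    and "j \<le> k \<Longrightarrow> poly ((pderiv ^^ j) (cell_poly k f i)) (node i) = (deriv ^^ j) f (node i)"
    and "j \<le> k \<Longrightarrow> poly ((pderiv ^^ j) (cell_poly k f i)) (node (i + 1)) = (deriv ^^ j) f (node (i + 1))"
  unfolding cell_poly_def using hermite_poly_props[of "node i" "node (i + 1)"] node_less[of i] by auto

lemma hermite_chain_node: "j \<le> k \<Longrightarrow> hermite_chain nx \<sigma> k f j (node i) = (deriv ^^ j) f (node i)"
  using cell_poly_props(2)[of j k f i] cell_eq_iff[of "node i" i] node_less[of i]
  by (simp add: hermite_chain_eq)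

lemma hermite_chain_cell:
  assumes "node i \<le> x" "x < node (i + 1)"
  shows "hermite_chain nx \<sigma> k f j x = poly ((pderiv ^^ j) (cell_poly k f i)) x"
  using assms cell_eq_iff[of x i] by (simp add: hermite_chain_eq)

lemma hermite_chain_closed_cell:
  assumes "node i \<le> x" "x \<le> node (i + 1)" "j \<le> k"
  shows "hermite_chain nx \<sigma> k f j x = poly ((pderiv ^^ j) (cell_poly k f i)) x"
proof (cases "x = node (i + 1)")
  case True
  then show ?thesis using cell_poly_props(3)[OF assms(3)] hermite_chain_node[OF assms(3)] by simp
qed (use assms hermite_chain_cell in auto)

text \<open>Matching jets make orders up to \<open>k\<close> continuous across nodes, so the
  boundary values of neighbouring cells telescope. The next order may jump, which is why the right
  end of a cell is discarded as a null set.\<close>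

lemma hermite_chain_has_integral:
  assumes "j \<le> k" "a \<le> b"
  shows "(hermite_chain nx \<sigma> k f (Suc j) has_integral
    hermite_chain nx \<sigma> k f j b - hermite_chain nx \<sigma> k f j a) {a..b}"
proof (rule cells_induct[OF _ _ assms(2)])
  fix a b c :: real assume "a \<le> b" "b \<le> c"
    "(hermite_chain nx \<sigma> k f (Suc j) has_integral
      hermite_chain nx \<sigma> k f j b - hermite_chain nx \<sigma> k f j a) {a..b}"
    "(hermite_chain nx \<sigma> k f (Suc j) has_integral
      hermite_chain nx \<sigma> k f j c - hermite_chain nx \<sigma> k f j b) {b..c}"
  from has_integral_combine[OF this]
  show "(hermite_chain nx \<sigma> k f (Suc j) has_integral
      hermite_chain nx \<sigma> k f j c - hermite_chain nx \<sigma> k f j a) {a..c}" by simp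
next
  fix i a b assume i: "node i \<le> a" "a \<le> b" "b \<le> node (i + 1)"
  let ?p = "cell_poly k f i"
  have "(poly (pderiv ((pderiv ^^ j) ?p)) has_integral
      poly ((pderiv ^^ j) ?p) b - poly ((pderiv ^^ j) ?p) a) {a..b}"
    using i(2) by (rule fundamental_theorem_of_calculus)
      (simp add: has_real_derivative_iff_has_vector_derivative[symmetric]
        has_field_derivative_at_within[OF poly_DERIV])
  then have "(hermite_chain nx \<sigma> k f (Suc j) has_integral
      poly ((pderiv ^^ j) ?p) b - poly ((pderiv ^^ j) ?p) a) {a..b}"
    by (rule has_integral_spike_finite[of "{node (i + 1)}", rotated 2])
      (use i hermite_chain_cell[of i _ k f "Suc j"] in auto)
  then show "(hermite_chain nx \<sigma> k f (Suc j) has_integral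
      hermite_chain nx \<sigma> k f j b - hermite_chain nx \<sigma> k f j a) {a..b}"
    using i hermite_chain_closed_cell[of i a j k f] hermite_chain_closed_cell[of i b j k f] assms(1)
    by simp
qed

lemma hermite_chain_L2: "locally_L2 (hermite_chain nx \<sigma> k f j)"
  unfolding locally_L2_def
proof (intro conjI allI)
  have "cell \<in> measurable borel (count_space UNIV)"
    unfolding cell_def[abs_def] by measurable
  moreover have "poly p \<in> borel_measurable borel" for p :: "real poly"
    by (intro borel_measurable_continuous_onI continuous_intros)
  ultimately have "(\<lambda>x. poly ((pderiv ^^ j) (cell_poly k f (cell x))) x) \<in> borel_measurable borel"
    using measurable_compose_countable[of "\<lambda>i x. poly ((pderiv ^^ j) (cell_poly k f i)) x" borel borel cell]
    by blast
  then have "hermite_chain nx \<sigma> k f j \<in> borel_measurable borel"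
    unfolding hermite_chain_eq[abs_def] .
  then show "hermite_chain nx \<sigma> k f j \<in> borel_measurable lebesgue"
    by (simp add: measurable_completion)
  fix a b :: real
  show "(\<lambda>x. (hermite_chain nx \<sigma> k f j x)\<^sup>2) integrable_on {a..b}"
  proof (cases "a \<le> b")
    case True
    show ?thesis
    proof (rule cells_induct[OF _ _ True])
      fix i a b assume i: "node i \<le> a" "a \<le> b" "b \<le> node (i + 1)"
      have "(\<lambda>x. (poly ((pderiv ^^ j) (cell_poly k f i)) x)\<^sup>2) integrable_on {a..b}"
        by (rule locally_L2_square_integrable) simp
      then show "(\<lambda>x. (hermite_chain nx \<sigma> k f j x)\<^sup>2) integrable_on {a..b}"
        by (rule integrable_spike_finite[of "{node (i + 1)}", rotated 2])
          (use i hermite_chain_cell[of i _ k f j] in auto)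
    qed (rule Henstock_Kurzweil_Integration.integrable_combine)
  qed auto
qed

lemma hermite_chain_sobolev: "sobolev_chain (Suc k) (hermite_chain nx \<sigma> k f)"
  unfolding sobolev_chain_def
  using hermite_chain_L2 integral_unique[OF hermite_chain_has_integral, symmetric]
  by (auto simp: less_Suc_eq_le)

lemma cell_poly_period:
  assumes "periodic f"
  shows "cell_poly k f (i + int nx) = pcompose (cell_poly k f i) [:- 2 * pi, 1:]"
  unfolding cell_poly_def[of k f "i + int nx"]
proof (rule hermite_poly_eqI)
  have n: "node (i + int nx) = node i + 2 * pi" "node (i + int nx + 1) = node (i + 1) + 2 * pi"
    using node_period[of i] node_period[of "i + 1"] by (simp_all add: add_ac)
  show "node (i + int nx) \<noteq> node (i + int nx + 1)" using node_less[of "i + int nx"] by simp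
  show "degree (pcompose (cell_poly k f i) [:- 2 * pi, 1:]) \<le> 2 * k + 1"
    using cell_poly_props(1)[of k f i] by (simp add: degree_pcompose)
  fix j assume j: "j \<le> k"
  have per: "(deriv ^^ j) f (x + 2 * pi) = (deriv ^^ j) f x" for x
    using higher_deriv_periodic[OF assms, of j] by (simp add: periodic_def)
  show "poly ((pderiv ^^ j) (pcompose (cell_poly k f i) [:- 2 * pi, 1:])) (node (i + int nx))
      = (deriv ^^ j) f (node (i + int nx))"
    using cell_poly_props(2)[OF j, of f i]
    by (simp add: higher_pderiv_pcompose_shift poly_pcompose n per)
  show "poly ((pderiv ^^ j) (pcompose (cell_poly k f i) [:- 2 * pi, 1:])) (node (i + int nx + 1))
      = (deriv ^^ j) f (node (i + int nx + 1))"
    using cell_poly_props(3)[OF j, of f i]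
    by (simp add: higher_pderiv_pcompose_shift poly_pcompose n per)
qed

lemma periodic_chain_hermite:
  assumes "periodic f"
  shows "periodic_chain (Suc k) (hermite_chain nx \<sigma> k f)"
  unfolding periodic_chain_def
proof (intro conjI allI impI hermite_chain_sobolev)
  fix j
  have "cell (x + 2 * pi) = cell x + int nx" for x
    using node_cell[of x] node_period[of "cell x"] node_period[of "cell x + 1"]
    unfolding cell_eq_iff by (simp add: add_ac)
  then show "periodic (hermite_chain nx \<sigma> k f j)"
    using cell_poly_period[OF assms]
    by (simp add: periodic_def hermite_chain_eq higher_pderiv_pcompose_shift poly_pcompose)
qed

section \<open>The interpolation error: orthogonality and size\<close>

definition hermite_error :: "nat \<Rightarrow> (nat \<Rightarrow> real \<Rightarrow> real) \<Rightarrow> nat \<Rightarrow> real \<Rightarrow> real" where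
  "hermite_error k F j x = F j x - hermite_chain nx \<sigma> k (F 0) j x"

lemma periodic_chain_hermite_error:
  assumes "periodic_chain (Suc k) F"
  shows "periodic_chain (Suc k) (hermite_error k F)"
  using assms periodic_chain_hermite[of "F 0" k] sobolev_chain_diff
  unfolding periodic_chain_def hermite_error_def[abs_def] by (auto simp: periodic_def)

lemma hermite_error_node:
  assumes "periodic_chain (Suc k) F" "j \<le> k"
  shows "hermite_error k F j (node i) = 0"
  using assms sobolev_chain_higher_deriv[of "Suc k" F j]
  by (simp add: hermite_error_def hermite_chain_node periodic_chain_def)

lemma hermite_error_cell_orthogonal:
  assumes "periodic_chain (Suc k) F" "(pderiv ^^ Suc k) r = 0"
  shows "integral {node i..node (i + 1)} (\<lambda>x. hermite_error k F (Suc k) x * poly r x) = 0"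
  using periodic_chain_hermite_error[OF assms(1)] hermite_error_node[OF assms(1)] assms(2) node_less[of i]
  by (intro sobolev_chain_orthogonal_poly) (auto simp: periodic_chain_def)

text \<open>The degrees fit exactly: differentiating degree \<open>2k+1\<close> as often as
  \<open>k+1\<close> times leaves degree at most \<open>k\<close>, the polynomials to which the top
  derivative of an error is orthogonal.\<close>

lemma higher_pderiv_cell_poly: "(pderiv ^^ Suc k) ((pderiv ^^ Suc k) (cell_poly k f i)) = 0"
proof -
  have "(pderiv ^^ (Suc k + Suc k)) (cell_poly k f i) = 0"
    using cell_poly_props(1)[of k f i] by (intro higher_pderiv_eq_0) simp
  then show ?thesis by (simp only: funpow_add o_apply)
qed

text \<open>\<open>f\<close> is independent of \<open>F\<close> and enters only through its
  piecewise polynomial; this allows differences of two interpolants as test functions.\<close>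

lemma hermite_orthogonal:
  assumes F: "periodic_chain (Suc k) F" and f: "periodic f"
  shows "integral {-pi..pi} (\<lambda>x. hermite_error k F (Suc k) x * hermite_chain nx \<sigma> k f (Suc k) x) = 0"
proof -
  let ?g = "\<lambda>x. hermite_error k F (Suc k) x * hermite_chain nx \<sigma> k f (Suc k) x"
  have E: "periodic_chain (Suc k) (hermite_error k F)" by (rule periodic_chain_hermite_error[OF F])
  have "periodic ?g"
    using periodic_chain_periodic[OF E] periodic_chain_periodic[OF periodic_chain_hermite[OF f]]
    by (auto simp: periodic_def)
  moreover have "?g integrable_on {a..b}" for a b
    by (intro locally_L2_mult_integrable hermite_chain_L2 periodic_chain_L2[OF E]) simp
  moreover have "integral {node i..node (i + 1)} ?g = 0" for i
  proof -
    have "integral {node i..node (i + 1)} ?g = integral {node i..node (i + 1)}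
        (\<lambda>x. hermite_error k F (Suc k) x * poly ((pderiv ^^ Suc k) (cell_poly k f i)) x)"
      by (rule integral_spike[of "{node (i + 1)}"]) (use hermite_chain_cell[of i _ k f "Suc k"] in auto)
    then show ?thesis
      using hermite_error_cell_orthogonal[OF F higher_pderiv_cell_poly] by simp
  qed
  ultimately show ?thesis using integral_cells[of ?g] by simp
qed

lemma hermite_error_low:
  assumes F: "periodic_chain (Suc k) F" and j: "j \<le> Suc k"
  shows "integral {-pi..pi} (\<lambda>x. (hermite_error k F j x)\<^sup>2)
    \<le> h ^ (2 * (Suc k - j)) * integral {-pi..pi} (\<lambda>x. (hermite_error k F (Suc k) x)\<^sup>2)"
proof -
  have E: "periodic_chain (Suc k) (hermite_error k F)" by (rule periodic_chain_hermite_error[OF F])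
  have sum: "integral {-pi..pi} (\<lambda>x. (hermite_error k F l x)\<^sup>2)
      = (\<Sum>i<nx. integral {node (int i)..node (int i + 1)} (\<lambda>x. (hermite_error k F l x)\<^sup>2))"
    if "l \<le> Suc k" for l
    using periodic_chain_periodic[OF E that] periodic_chain_L2[OF E that]
    by (intro integral_cells locally_L2_square_integrable) (auto simp: periodic_def)
  have "integral {node i..node (i + 1)} (\<lambda>x. (hermite_error k F j x)\<^sup>2)
      \<le> h ^ (2 * (Suc k - j)) * integral {node i..node (i + 1)} (\<lambda>x. (hermite_error k F (Suc k) x)\<^sup>2)" for i
    using sobolev_chain_poincare[of "Suc k" "hermite_error k F" j "node i" "node (i + 1)"] E j
      hermite_error_node[OF F] node_less[of i] node_step[of i]
    by (simp add: periodic_chain_def)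
  then show ?thesis
    unfolding sum[OF j] sum[OF order_refl] sum_distrib_left by (intro sum_mono)
qed

text \<open>By orthogonality, the derivative of order \<open>k + 1\<close> of the interpolant is on every cell the best
  approximation of that of the function by polynomials of degree at most \<open>k\<close>; it is compared
  with a Taylor polynomial.\<close>

lemma hermite_error_top:
  assumes F: "periodic_chain (Suc k + l) F" and l: "l \<le> Suc k"
  shows "integral {-pi..pi} (\<lambda>x. (hermite_error k F (Suc k) x)\<^sup>2)
    \<le> h ^ (2 * l) * integral {-pi..pi} (\<lambda>x. (F (Suc k + l) x)\<^sup>2)"
proof -
  let ?E = "hermite_error k F (Suc k)"
  have F': "periodic_chain (Suc k) F" by (rule periodic_chain_mono[OF F]) simp
  have E: "periodic_chain (Suc k) (hermite_error k F)" by (rule periodic_chain_hermite_error[OF F'])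
  have EL: "locally_L2 ?E" by (rule periodic_chain_L2[OF E order_refl])
  have cell: "integral {node i..node (i + 1)} (\<lambda>x. (?E x)\<^sup>2)
      \<le> h ^ (2 * l) * integral {node i..node (i + 1)} (\<lambda>x. (F (Suc k + l) x)\<^sup>2)" for i
  proof -
    let ?C = "{node i..node (i + 1)}"
    have "sobolev_chain l (\<lambda>j. F (Suc k + j))"
      using F by (intro sobolev_chain_drop) (simp add: periodic_chain_def)
    then obtain r where r: "(pderiv ^^ l) r = 0"
      and taylor: "integral ?C (\<lambda>x. (F (Suc k) x - poly r x)\<^sup>2)
        \<le> h ^ (2 * l) * integral ?C (\<lambda>x. (F (Suc k + l) x)\<^sup>2)"
      using sobolev_chain_taylor[of l "\<lambda>j. F (Suc k + j)" "node i" "node (i + 1)"] node_step[of i] node_less[of i]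
      by auto
    define q where "q = (pderiv ^^ Suc k) (cell_poly k (F 0) i) - r"
    \<comment> \<open>Here \<open>l \<le> Suc k\<close> keeps the Taylor polynomial within the
      degrees covered by orthogonality. The velocity, with \<open>k = m - 1\<close> and
      \<open>l = m\<close>, attains the limit.\<close>
    have "(pderiv ^^ (Suc k - l + l)) r = 0"
      unfolding funpow_add o_apply r by simp
    then have "(pderiv ^^ Suc k) r = 0" using l by simp
    then have "(pderiv ^^ Suc k) q = 0"
      unfolding q_def higher_pderiv_diff higher_pderiv_cell_poly by simp
    then have orth: "integral ?C (\<lambda>x. ?E x * poly q x) = 0"
      by (rule hermite_error_cell_orthogonal[OF F'])
    have "integral ?C (\<lambda>x. (?E x)\<^sup>2) \<le> integral ?C (\<lambda>x. (?E x + poly q x)\<^sup>2)"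
      using integral_square_nonneg[OF locally_L2_poly, of "node i" "node (i + 1)" q]
      by (simp add: integral_square_add[OF EL locally_L2_poly] orth)
    also have "\<dots> = integral ?C (\<lambda>x. (F (Suc k) x - poly r x)\<^sup>2)"
      by (rule integral_spike[of "{node (i + 1)}"])
        (use hermite_chain_cell[of i _ k "F 0" "Suc k"] in \<open>auto simp: hermite_error_def q_def\<close>)
    finally show ?thesis using taylor by simp
  qed
  have "integral {-pi..pi} (\<lambda>x. (?E x)\<^sup>2)
      = (\<Sum>i<nx. integral {node (int i)..node (int i + 1)} (\<lambda>x. (?E x)\<^sup>2))"
    using periodic_chain_periodic[OF E order_refl] EL
    by (intro integral_cells locally_L2_square_integrable) (auto simp: periodic_def)
  also have "\<dots> \<le> (\<Sum>i<nx. h ^ (2 * l) *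
      integral {node (int i)..node (int i + 1)} (\<lambda>x. (F (Suc k + l) x)\<^sup>2))"
    by (intro sum_mono cell)
  also have "\<dots> = h ^ (2 * l) * integral {-pi..pi} (\<lambda>x. (F (Suc k + l) x)\<^sup>2)"
    unfolding sum_distrib_left[symmetric]
    using periodic_chain_periodic[OF F order_refl] periodic_chain_L2[OF F order_refl]
    by (subst integral_cells) (auto simp: periodic_def intro: locally_L2_square_integrable)
  finally show ?thesis .
qed

end

section \<open>Error propagation over one half step\<close>

context grid
begin

text \<open>With \<open>E\<close>, \<open>E'\<close> the interpolation errors and \<open>D\<close>
  the difference of the two interpolants, both \<open>E + D\<close> and \<open>(E - E') + D\<close>
  are orthogonal sums; eliminating the squared norm of \<open>D\<close> gives the identity.\<close>

lemma hermite_pythagoras: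
  assumes F: "periodic_chain (Suc k) F" and F': "periodic_chain (Suc k) F'"
  shows "integral {-pi..pi} (\<lambda>x. (F (Suc k) x - hermite_chain nx \<sigma> k (F' 0) (Suc k) x)\<^sup>2)
      + integral {-pi..pi} (\<lambda>x. (hermite_error k F (Suc k) x - hermite_error k F' (Suc k) x)\<^sup>2)
    = integral {-pi..pi} (\<lambda>x. (hermite_error k F (Suc k) x)\<^sup>2)
      + integral {-pi..pi} (\<lambda>x. (F (Suc k) x - F' (Suc k) x)\<^sup>2)"
proof -
  let ?E = "hermite_error k F (Suc k)" and ?E' = "hermite_error k F' (Suc k)"
  let ?I = "hermite_chain nx \<sigma> k (F 0) (Suc k)" and ?I' = "hermite_chain nx \<sigma> k (F' 0) (Suc k)"
  let ?D = "\<lambda>x. ?I x - ?I' x"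
  have per: "periodic (F 0)" "periodic (F' 0)"
    using F F' by (auto intro: periodic_chain_periodic)
  have L: "locally_L2 ?E" "locally_L2 ?E'" "locally_L2 ?I" "locally_L2 ?I'"
    using periodic_chain_L2[OF periodic_chain_hermite_error[OF F]]
      periodic_chain_L2[OF periodic_chain_hermite_error[OF F']] hermite_chain_L2 by auto
  note i = locally_L2_mult_integrable
  have orth: "integral {-pi..pi} (\<lambda>x. hermite_error k G (Suc k) x * ?D x) = 0"
    if "periodic_chain (Suc k) G" for G
    using hermite_orthogonal[OF that per(1)] hermite_orthogonal[OF that per(2)]
      i[OF periodic_chain_L2[OF periodic_chain_hermite_error[OF that] order_refl] L(3)]
      i[OF periodic_chain_L2[OF periodic_chain_hermite_error[OF that] order_refl] L(4)]
    by (simp add: right_diff_distrib integral_diff)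
  have "integral {-pi..pi} (\<lambda>x. (?E x - ?E' x) * ?D x)
      = integral {-pi..pi} (\<lambda>x. ?E x * ?D x) - integral {-pi..pi} (\<lambda>x. ?E' x * ?D x)"
    unfolding left_diff_distrib[of _ _ "?D _"] using L
    by (intro integral_diff i locally_L2_diff)
  then have "integral {-pi..pi} (\<lambda>x. (?E x - ?E' x) * ?D x) = 0"
    using orth[OF F] orth[OF F'] by simp
  moreover have "integral {-pi..pi} (\<lambda>x. (?E x + ?D x)\<^sup>2)
      = integral {-pi..pi} (\<lambda>x. (?E x)\<^sup>2) + integral {-pi..pi} (\<lambda>x. (?D x)\<^sup>2)"
    using integral_square_add[OF L(1) locally_L2_diff[OF L(3,4)]] orth[OF F] by simp
  moreover have "integral {-pi..pi} (\<lambda>x. ((?E x - ?E' x) + ?D x)\<^sup>2)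
      = integral {-pi..pi} (\<lambda>x. (?E x - ?E' x)\<^sup>2) + 2 * integral {-pi..pi} (\<lambda>x. (?E x - ?E' x) * ?D x)
        + integral {-pi..pi} (\<lambda>x. (?D x)\<^sup>2)"
    by (rule integral_square_add[OF locally_L2_diff[OF L(1,2)] locally_L2_diff[OF L(3,4)]])
  moreover have "(\<lambda>x. (?E x + ?D x)\<^sup>2) = (\<lambda>x. (F (Suc k) x - ?I' x)\<^sup>2)"
    "(\<lambda>x. ((?E x - ?E' x) + ?D x)\<^sup>2) = (\<lambda>x. (F (Suc k) x - F' (Suc k) x)\<^sup>2)"
    by (simp_all add: hermite_error_def)
  ultimately show ?thesis by simp
qed

text \<open>Here \<open>(F, G)\<close> is the exact solution at the new time level and \<open>(F', G')\<close> the evolved numerical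
  solution before interpolation. The quantity \<open>\<theta>\<close> is the part of the error that the interpolation
  removes; it enters the low order error but is paid for by the high order one.\<close>

lemma hermite_step:
  assumes m: "1 \<le> m" and F: "periodic_chain (2 * m + 1) F" and G: "periodic_chain (2 * m) G"
    and F': "periodic_chain (Suc m) F'" and G': "periodic_chain m G'"
    and \<eta>: "\<eta> = h ^ m * sqrt (wave_energy c (F (2 * m + 1)) (G (2 * m)))"
  shows "\<exists>\<theta>\<ge>0.
    wave_energy c (\<lambda>x. F (Suc m) x - hermite_chain nx \<sigma> m (F' 0) (Suc m) x)
        (\<lambda>x. G m x - hermite_chain nx \<sigma> (m - 1) (G' 0) m x)
      \<le> \<eta>\<^sup>2 + wave_energy c (\<lambda>x. F (Suc m) x - F' (Suc m) x) (\<lambda>x. G m x - G' m x) - \<theta>\<^sup>2 \<and>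
    sqrt (wave_energy c (\<lambda>x. F 1 x - hermite_chain nx \<sigma> m (F' 0) 1 x)
        (\<lambda>x. G 0 x - hermite_chain nx \<sigma> (m - 1) (G' 0) 0 x))
      \<le> sqrt (wave_energy c (\<lambda>x. F 1 x - F' 1 x) (\<lambda>x. G 0 x - G' 0 x)) + h ^ m * (\<eta> + \<theta>)"
proof -
  define l where "l = m - 1"
  have ml: "m = Suc l" using m by (simp add: l_def)
  have F1: "periodic_chain (Suc m) F" and G1: "periodic_chain m G"
    using periodic_chain_mono[OF F] periodic_chain_mono[OF G] by auto
  have G2: "periodic_chain (Suc l) G" "periodic_chain (Suc l) G'" using G1 G' ml by simp_all
  let ?EF = "hermite_error m F" and ?EF' = "hermite_error m F'"
  let ?EG = "hermite_error l G" and ?EG' = "hermite_error l G'"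
  have LF: "locally_L2 (?EF j)" "locally_L2 (?EF' j)" if "j \<le> Suc m" for j
    using periodic_chain_L2[OF periodic_chain_hermite_error[OF F1] that]
      periodic_chain_L2[OF periodic_chain_hermite_error[OF F'] that] by auto
  have LG: "locally_L2 (?EG j)" "locally_L2 (?EG' j)" if "j \<le> m" for j
    using periodic_chain_L2[OF periodic_chain_hermite_error[OF G2(1)]]
      periodic_chain_L2[OF periodic_chain_hermite_error[OF G2(2)]] that ml by auto
  define T where "T = wave_energy c (\<lambda>x. ?EF (Suc m) x - ?EF' (Suc m) x) (\<lambda>x. ?EG m x - ?EG' m x)"
  have T': "T = wave_energy c (\<lambda>x. ?EF' (Suc m) x - ?EF (Suc m) x) (\<lambda>x. ?EG' m x - ?EG m x)"
    by (simp add: T_def wave_energy_def power2_commute)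
  have T0: "0 \<le> T"
    unfolding T_def using LF LG by (intro wave_energy_nonneg locally_L2_diff) auto
  have pyth: "wave_energy c (\<lambda>x. F (Suc m) x - hermite_chain nx \<sigma> m (F' 0) (Suc m) x)
        (\<lambda>x. G m x - hermite_chain nx \<sigma> l (G' 0) m x) + T
      = wave_energy c (?EF (Suc m)) (?EG m)
        + wave_energy c (\<lambda>x. F (Suc m) x - F' (Suc m) x) (\<lambda>x. G m x - G' m x)"
    using arg_cong[OF hermite_pythagoras[OF F1 F'], of "\<lambda>z. c\<^sup>2 * z"] hermite_pythagoras[OF G2, folded ml]
    by (simp add: T_def wave_energy_def distrib_left)
  have top: "wave_energy c (?EF (Suc m)) (?EG m) \<le> \<eta>\<^sup>2"
  proof -
    have "integral {-pi..pi} (\<lambda>x. (?EF (Suc m) x)\<^sup>2) \<le> h ^ (2 * m) * integral {-pi..pi} (\<lambda>x. (F (2 * m + 1) x)\<^sup>2)"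
      using hermite_error_top[of m m F] F by (simp add: mult_2)
    moreover have "integral {-pi..pi} (\<lambda>x. (?EG m x)\<^sup>2) \<le> h ^ (2 * m) * integral {-pi..pi} (\<lambda>x. (G (2 * m) x)\<^sup>2)"
      using hermite_error_top[of l m G] G ml by (simp add: mult_2)
    ultimately have "wave_energy c (?EF (Suc m)) (?EG m)
        \<le> c\<^sup>2 * (h ^ (2 * m) * integral {-pi..pi} (\<lambda>x. (F (2 * m + 1) x)\<^sup>2))
          + h ^ (2 * m) * integral {-pi..pi} (\<lambda>x. (G (2 * m) x)\<^sup>2)"
      unfolding wave_energy_def by (intro add_mono mult_left_mono) auto
    also have "\<dots> = h ^ (2 * m) * wave_energy c (F (2 * m + 1)) (G (2 * m))"
      by (simp add: wave_energy_def distrib_left mult_ac)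
    also have "\<dots> = \<eta>\<^sup>2"
    proof -
      have "0 \<le> wave_energy c (F (2 * m + 1)) (G (2 * m))"
        by (intro wave_energy_nonneg periodic_chain_L2[OF F] periodic_chain_L2[OF G]) auto
      then show ?thesis unfolding \<eta> by (simp add: power_mult_distrib power_mult[symmetric] mult.commute)
    qed
    finally show ?thesis .
  qed
  have \<eta>0: "0 \<le> \<eta>"
    using h_pos unfolding \<eta>
    by (intro mult_nonneg_nonneg real_sqrt_ge_zero wave_energy_nonneg periodic_chain_L2[OF F]
        periodic_chain_L2[OF G]) auto
  \<comment> \<open>Both components gain exactly \<open>h^m\<close>: the displacement descends from
    order \<open>m + 1\<close> to 1, the velocity from \<open>m\<close> to 0. The high order error
    of the numerical solution is then compared with that of the exact one, which costs \<eta> and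
    the square root of \<open>T\<close>.\<close>
  have low: "sqrt (wave_energy c (?EF' 1) (?EG' 0)) \<le> h ^ m * (\<eta> + sqrt T)"
  proof -
    have "integral {-pi..pi} (\<lambda>x. (?EF' 1 x)\<^sup>2) \<le> h ^ (2 * m) * integral {-pi..pi} (\<lambda>x. (?EF' (Suc m) x)\<^sup>2)"
      using hermite_error_low[OF F', of 1] by simp
    moreover have "integral {-pi..pi} (\<lambda>x. (?EG' 0 x)\<^sup>2) \<le> h ^ (2 * m) * integral {-pi..pi} (\<lambda>x. (?EG' m x)\<^sup>2)"
      using hermite_error_low[OF G2(2), of 0, folded ml] by simp
    ultimately have "wave_energy c (?EF' 1) (?EG' 0)
        \<le> c\<^sup>2 * (h ^ (2 * m) * integral {-pi..pi} (\<lambda>x. (?EF' (Suc m) x)\<^sup>2))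
          + h ^ (2 * m) * integral {-pi..pi} (\<lambda>x. (?EG' m x)\<^sup>2)"
      unfolding wave_energy_def by (intro add_mono mult_left_mono) auto
    also have "\<dots> = (h ^ m)\<^sup>2 * wave_energy c (?EF' (Suc m)) (?EG' m)"
      by (simp add: wave_energy_def distrib_left mult_ac power_mult[symmetric])
    finally have "sqrt (wave_energy c (?EF' 1) (?EG' 0))
        \<le> sqrt ((h ^ m)\<^sup>2 * wave_energy c (?EF' (Suc m)) (?EG' m))"
      by (rule real_sqrt_le_mono)
    also have "\<dots> = h ^ m * sqrt (wave_energy c (?EF' (Suc m)) (?EG' m))"
      using h_pos by (simp add: real_sqrt_mult)
    also have "\<dots> \<le> h ^ m * (\<eta> + sqrt T)"
    proof (rule mult_left_mono)
      have "sqrt (wave_energy c (?EF' (Suc m)) (?EG' m))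
          \<le> sqrt (wave_energy c (?EF (Suc m)) (?EG m)) + sqrt T"
        unfolding T'
        using wave_energy_triangle[OF LF(1) LG(1) locally_L2_diff[OF LF(2,1)] locally_L2_diff[OF LG(2,1)],
            of "Suc m" m "Suc m" "Suc m" m m c] by simp
      also have "sqrt (wave_energy c (?EF (Suc m)) (?EG m)) \<le> \<eta>"
        using real_sqrt_le_mono[OF top] \<eta>0 by simp
      finally show "sqrt (wave_energy c (?EF' (Suc m)) (?EG' m)) \<le> \<eta> + sqrt T" by simp
    qed (use h_pos in simp)
    finally show ?thesis .
  qed
  \<comment> \<open>The new error splits into the error before interpolation and what interpolation
    changes in the numerical solution.\<close>
  have "sqrt (wave_energy c (\<lambda>x. (F 1 x - F' 1 x) + ?EF' 1 x) (\<lambda>x. (G 0 x - G' 0 x) + ?EG' 0 x))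
      \<le> sqrt (wave_energy c (\<lambda>x. F 1 x - F' 1 x) (\<lambda>x. G 0 x - G' 0 x))
        + sqrt (wave_energy c (?EF' 1) (?EG' 0))"
    by (intro wave_energy_triangle locally_L2_diff LF LG periodic_chain_L2[OF F1]
        periodic_chain_L2[OF F'] periodic_chain_L2[OF G1] periodic_chain_L2[OF G']) auto
  also have "(\<lambda>x. (F 1 x - F' 1 x) + ?EF' 1 x) = (\<lambda>x. F 1 x - hermite_chain nx \<sigma> m (F' 0) 1 x)"
    by (simp add: hermite_error_def)
  also have "(\<lambda>x. (G 0 x - G' 0 x) + ?EG' 0 x) = (\<lambda>x. G 0 x - hermite_chain nx \<sigma> l (G' 0) 0 x)"
    by (simp add: hermite_error_def)
  finally have "sqrt (wave_energy c (\<lambda>x. F 1 x - hermite_chain nx \<sigma> m (F' 0) 1 x)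
        (\<lambda>x. G 0 x - hermite_chain nx \<sigma> l (G' 0) 0 x))
      \<le> sqrt (wave_energy c (\<lambda>x. F 1 x - F' 1 x) (\<lambda>x. G 0 x - G' 0 x)) + h ^ m * (\<eta> + sqrt T)"
    using low by simp
  then show ?thesis
    unfolding l_def[symmetric] using pyth top T0 by (intro exI[of _ "sqrt T"]) simp
qed

end

text \<open>Plays the role of Cauchy-Schwarz for the sum of the \<theta>: since their squares are
  paid for by \<open>e\<close>, the growth is linear in \<open>n\<close> instead of of order
  \<open>n * sqrt n\<close>.\<close>

lemma error_recursion:
  fixes e L :: "nat \<Rightarrow> real"
  assumes 0: "e 0 = 0" "L 0 = 0" and e: "\<And>n. 0 \<le> e n" and \<delta>: "0 \<le> \<delta>" and \<eta>: "0 \<le> \<eta>"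
    and step: "\<And>n. \<exists>\<theta>\<ge>0. e (Suc n) \<le> \<eta>\<^sup>2 + e n - \<theta>\<^sup>2 \<and> L (Suc n) \<le> L n + \<delta> * (\<eta> + \<theta>)"
  shows "L n \<le> 2 * real n * \<delta> * \<eta>"
proof (cases "\<eta> = 0")
  \<comment> \<open>The weight \<open>2 * \<eta>\<close> used in the other case degenerates here;
    instead \<open>e\<close> stays 0, which forces every \<theta> to vanish.\<close>
  case True
  have "e n = 0 \<and> L n \<le> 0" for n
  proof (induction n)
    case (Suc n)
    obtain \<theta> where "0 \<le> \<theta>" "e (Suc n) \<le> \<eta>\<^sup>2 + e n - \<theta>\<^sup>2" "L (Suc n) \<le> L n + \<delta> * (\<eta> + \<theta>)"
      using step by blast
    then have "e (Suc n) \<le> - \<theta>\<^sup>2" "L (Suc n) \<le> \<delta> * \<theta>" using True Suc by auto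
    moreover have "\<theta>\<^sup>2 = 0" using calculation(1) e[of "Suc n"] zero_le_power2[of \<theta>] by linarith
    ultimately show ?case using e[of "Suc n"] by simp
  qed (use 0 in simp)
  then show ?thesis using True by simp
next
  case False
  then have \<eta>: "0 < \<eta>" using \<eta> by simp
  \<comment> \<open>The weight is chosen so that the contributions of \<theta> complete a square:
    one step adds \<open>4 * \<delta> * \<eta>^2 - \<delta> * (\<eta> - \<theta>)^2\<close>.\<close>
  have "2 * \<eta> * L n + \<delta> * e n \<le> 4 * real n * \<delta> * \<eta>\<^sup>2"
  proof (induction n)
    case (Suc n)
    obtain \<theta> where \<theta>: "e (Suc n) \<le> \<eta>\<^sup>2 + e n - \<theta>\<^sup>2" "L (Suc n) \<le> L n + \<delta> * (\<eta> + \<theta>)"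
      using step by blast
    have "2 * \<eta> * L (Suc n) + \<delta> * e (Suc n)
        \<le> 2 * \<eta> * (L n + \<delta> * (\<eta> + \<theta>)) + \<delta> * (\<eta>\<^sup>2 + e n - \<theta>\<^sup>2)"
      using \<theta> \<eta> \<delta> by (intro add_mono mult_left_mono) auto
    also have "\<dots> = 2 * \<eta> * L n + \<delta> * e n + 4 * \<delta> * \<eta>\<^sup>2 - \<delta> * (\<eta> - \<theta>)\<^sup>2"
      by (simp add: power2_eq_square algebra_simps)
    also have "\<dots> \<le> 2 * \<eta> * L n + \<delta> * e n + 4 * \<delta> * \<eta>\<^sup>2" using \<delta> by simp
    also have "\<dots> \<le> 4 * real (Suc n) * \<delta> * \<eta>\<^sup>2" using Suc by (simp add: algebra_simps)
    finally show ?case .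
  qed (use 0 in simp)
  moreover have "0 \<le> \<delta> * e n" using \<delta> e by simp
  ultimately have "(2 * \<eta>) * L n \<le> (2 * \<eta>) * (2 * real n * \<delta> * \<eta>)"
    by (simp add: power2_eq_square algebra_simps)
  then show ?thesis using \<eta> by (simp add: mult_ac)
qed

section \<open>The error estimate\<close>

text \<open>Runs the method on whole chains, because the density of top order cannot be recovered
  from the function by \<open>deriv\<close>.\<close>

primrec method_chains ::
    "nat \<Rightarrow> real \<Rightarrow> nat \<Rightarrow> real \<Rightarrow> (real \<Rightarrow> real) \<Rightarrow> (real \<Rightarrow> real) \<Rightarrow>
     nat \<Rightarrow> (nat \<Rightarrow> real \<Rightarrow> real) \<times> (nat \<Rightarrow> real \<Rightarrow> real)" where
  "method_chains m c nx dt g0 g1 0 =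
     (hermite_chain nx (grid_offset 0) m g0, hermite_chain nx (grid_offset 0) (m - 1) g1)"
| "method_chains m c nx dt g0 g1 (Suc k) =
     (let (P, Q) = method_chains m c nx dt g0 g1 k
      in (hermite_chain nx (grid_offset (Suc k)) m (wave_chain_u c (dt / 2) P Q 0),
          hermite_chain nx (grid_offset (Suc k)) (m - 1) (wave_chain_v c (dt / 2) P Q 0)))"

lemma method_chains_correct:
  assumes m: "1 \<le> m" and nx: "1 \<le> nx" and c: "0 < c" and dt: "0 \<le> dt"
    and per: "periodic g0" "periodic g1" and eq: "method_chains m c nx dt g0 g1 k = (P, Q)"
  shows "periodic_chain (Suc m) P" "periodic_chain m Q" "hermite_method m c nx dt g0 g1 k = (P 0, Q 0)"
proof -
  have "periodic_chain (Suc m) P \<and> periodic_chain m Q \<and> hermite_method m c nx dt g0 g1 k = (P 0, Q 0)"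
    using eq
  proof (induction k arbitrary: P Q)
    case 0
    interpret grid nx "grid_offset 0" by unfold_locales (rule nx)
    show ?case
      using 0 periodic_chain_hermite[OF per(1), of m] periodic_chain_hermite[OF per(2), of "m - 1"] m
      by (auto simp: hermite_interp_eq_chain)
  next
    case (Suc k)
    interpret grid nx "grid_offset (Suc k)" by unfold_locales (rule nx)
    obtain P' Q' where eq': "method_chains m c nx dt g0 g1 k = (P', Q')" by fastforce
    have IH: "periodic_chain (Suc m) P'" "periodic_chain m Q'"
      "hermite_method m c nx dt g0 g1 k = (P' 0, Q' 0)" using Suc.IH[OF eq'] by auto
    have per': "periodic (wave_chain_u c (dt / 2) P' Q' 0)" "periodic (wave_chain_v c (dt / 2) P' Q' 0)"
      using periodic_chain_periodic[OF periodic_chain_wave_u[OF IH(1,2)]]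
        periodic_chain_periodic[OF periodic_chain_wave_v[OF IH(1,2)]] by auto
    have "wave_evolution c (dt / 2) (P' 0, Q' 0)
        = (wave_chain_u c (dt / 2) P' Q' 0, wave_chain_v c (dt / 2) P' Q' 0)"
      by (rule wave_evolution_chain[OF IH(1,2) m c]) (use dt in simp)
    then show ?case
      using Suc.prems periodic_chain_hermite[OF per'(1), of m] periodic_chain_hermite[OF per'(2), of "m - 1"]
        m IH(3) eq'
      by (auto simp: hermite_interp_eq_chain)
  qed
  then show "periodic_chain (Suc m) P" "periodic_chain m Q"
    "hermite_method m c nx dt g0 g1 k = (P 0, Q 0)" by auto
qed

lemma wave_energy_wave_diff:
  assumes "locally_L2 f" "locally_L2 g" "locally_L2 f'" "locally_L2 g'"
    and "periodic f" "periodic g" "periodic f'" "periodic g'" and "c \<noteq> 0"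
  shows "wave_energy c (\<lambda>x. wave_u c t f g x - wave_u c t f' g' x) (\<lambda>x. wave_v c t f g x - wave_v c t f' g' x)
    = wave_energy c (\<lambda>x. f x - f' x) (\<lambda>x. g x - g' x)"
proof -
  have "(\<lambda>x. wave_u c t f g x - wave_u c t f' g' x) = wave_u c t (\<lambda>x. f x - f' x) (\<lambda>x. g x - g' x)"
    "(\<lambda>x. wave_v c t f g x - wave_v c t f' g' x) = wave_v c t (\<lambda>x. f x - f' x) (\<lambda>x. g x - g' x)"
    by (simp_all only: wave_u_diff wave_v_diff)
  moreover have "periodic (\<lambda>x. f x - f' x)" "periodic (\<lambda>x. g x - g' x)"
    using assms by (auto simp: periodic_def)
  ultimately show ?thesis using assms by (simp add: wave_energy_wave locally_L2_diff)
qed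

lemma hermite_method_energy_error:
  assumes m: "1 \<le> m" and nx: "1 \<le> nx" and c: "0 < c" and dt: "0 \<le> dt"
    and A: "periodic_chain (2 * m + 1) A" and B: "periodic_chain (2 * m) B"
    and eq: "method_chains m c nx dt (A 0) (B 0) k = (P, Q)"
  shows "sqrt (wave_energy c (\<lambda>x. wave_chain_u c (real k * (dt / 2)) A B 1 x - P 1 x)
      (\<lambda>x. wave_chain_v c (real k * (dt / 2)) A B 0 x - Q 0 x))
    \<le> 2 * real (Suc k) * mesh_size nx ^ (2 * m) * sqrt (wave_energy c (A (2 * m + 1)) (B (2 * m)))"
proof -
  define \<tau> where "\<tau> = dt / 2"
  define U where "U k = wave_chain_u c (real k * \<tau>) A B" for k
  define V where "V k = wave_chain_v c (real k * \<tau>) A B" for k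
  \<comment> \<open>The sequences shadow the fixed \<open>P\<close> and \<open>Q\<close>, which are
    recovered through \<open>eq\<close> at the end.\<close>
  define P where "P k = fst (method_chains m c nx dt (A 0) (B 0) k)" for k
  define Q where "Q k = snd (method_chains m c nx dt (A 0) (B 0) k)" for k
  define \<eta> where "\<eta> = mesh_size nx ^ m * sqrt (wave_energy c (A (2 * m + 1)) (B (2 * m)))"
  define e where "e k = wave_energy c (\<lambda>x. U k (Suc m) x - P k (Suc m) x) (\<lambda>x. V k m x - Q k m x)" for k
  define L where "L k = sqrt (wave_energy c (\<lambda>x. U k 1 x - P k 1 x) (\<lambda>x. V k 0 x - Q k 0 x))" for k
  have per: "periodic (A 0)" "periodic (B 0)"
    using periodic_chain_periodic[OF A] periodic_chain_periodic[OF B] by auto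
  have PQ: "periodic_chain (Suc m) (P k)" "periodic_chain m (Q k)" for k
    using method_chains_correct(1,2)[OF m nx c dt per, of k "P k" "Q k"] by (simp_all add: P_def Q_def)
  have A': "periodic_chain (Suc (2 * m)) A" using A by simp
  have UV: "periodic_chain (2 * m + 1) (U k)" "periodic_chain (2 * m) (V k)" for k
    unfolding U_def V_def using periodic_chain_wave_u[OF A' B] periodic_chain_wave_v[OF A' B] by simp_all
  have U_Suc: "U k (Suc j) = wave_u c (real k * \<tau>) (A (Suc j)) (B j)"
    and V_eq: "V k j = wave_v c (real k * \<tau>) (A (Suc j)) (B j)" for k j
    by (simp_all add: U_def V_def wave_chain_v_def)
  have "real k * \<tau> + \<tau> = real (Suc k) * \<tau>" for k by (simp add: algebra_simps)
  then have U_step: "U (Suc k) (Suc j) = wave_u c \<tau> (U k (Suc j)) (V k j)"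
    and V_step: "V (Suc k) j = wave_v c \<tau> (U k (Suc j)) (V k j)" for k j
    unfolding U_Suc V_eq using wave_u_wave[of c] wave_v_wave[of c] c by simp_all
  have U0: "U 0 j = A j" and V0: "V 0 j = B j" if "j \<le> 2 * m + 1" for j
    by (cases j; simp add: U_def V_def wave_chain_u_def wave_chain_v_def)+
  \<comment> \<open>Conservation at the top order lets one \<eta> serve all steps.\<close>
  have energy: "wave_energy c (U k (2 * m + 1)) (V k (2 * m)) = wave_energy c (A (2 * m + 1)) (B (2 * m))" for k
    unfolding Suc_eq_plus1[symmetric] U_Suc V_eq
    by (intro wave_energy_wave periodic_chain_L2[OF A'] periodic_chain_L2[OF B]
        periodic_chain_periodic[OF A'] periodic_chain_periodic[OF B]) (use c in auto)
  have isometry: "wave_energy c (\<lambda>x. U (Suc k) (Suc j) x - wave_chain_u c \<tau> (P k) (Q k) (Suc j) x)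
      (\<lambda>x. V (Suc k) j x - wave_chain_v c \<tau> (P k) (Q k) j x)
    = wave_energy c (\<lambda>x. U k (Suc j) x - P k (Suc j) x) (\<lambda>x. V k j x - Q k j x)" if "j \<le> m" for k j
    unfolding wave_chain_u_Suc wave_chain_v_def U_step V_step
    by (intro wave_energy_wave_diff periodic_chain_L2[OF UV(1)] periodic_chain_L2[OF UV(2)]
        periodic_chain_L2[OF PQ(1)] periodic_chain_L2[OF PQ(2)] periodic_chain_periodic[OF UV(1)]
        periodic_chain_periodic[OF UV(2)] periodic_chain_periodic[OF PQ(1)]
        periodic_chain_periodic[OF PQ(2)]) (use that c in auto)
  \<comment> \<open>The initial interpolation counts as a step that starts from zero error: the
    exact data take the place of the evolved numerical solution.\<close>
  have step0: "\<exists>\<theta>\<ge>0. e 0 \<le> \<eta>\<^sup>2 + 0 - \<theta>\<^sup>2 \<and> L 0 \<le> 0 + mesh_size nx ^ m * (\<eta> + \<theta>)"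
  proof -
    interpret grid nx "grid_offset 0" by unfold_locales (rule nx)
    have "wave_energy c (\<lambda>x. 0) (\<lambda>x. 0) = 0" by (simp add: wave_energy_def)
    then show ?thesis
      using hermite_step[OF m UV(1)[of 0] UV(2)[of 0] periodic_chain_mono[OF UV(1)[of 0], of "Suc m"]
          periodic_chain_mono[OF UV(2)[of 0], of m], of \<eta> c]
      by (simp add: energy \<eta>_def h_def e_def L_def P_def Q_def U0 V0)
  qed
  have step: "\<exists>\<theta>\<ge>0. e (Suc k) \<le> \<eta>\<^sup>2 + e k - \<theta>\<^sup>2 \<and> L (Suc k) \<le> L k + mesh_size nx ^ m * (\<eta> + \<theta>)" for k
  proof -
    interpret grid nx "grid_offset (Suc k)" by unfold_locales (rule nx)
    have PQ_Suc: "P (Suc k) = hermite_chain nx (grid_offset (Suc k)) m (wave_chain_u c \<tau> (P k) (Q k) 0)"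
      "Q (Suc k) = hermite_chain nx (grid_offset (Suc k)) (m - 1) (wave_chain_v c \<tau> (P k) (Q k) 0)"
      by (simp_all add: P_def Q_def \<tau>_def case_prod_unfold Let_def)
    show ?thesis
      using hermite_step[OF m UV(1)[of "Suc k"] UV(2)[of "Suc k"] periodic_chain_wave_u[OF PQ(1)[of k] PQ(2)[of k], of c \<tau>]
          periodic_chain_wave_v[OF PQ(1)[of k] PQ(2)[of k], of c \<tau>], of \<eta> c]
      unfolding e_def L_def PQ_Suc energy h_def isometry[OF order_refl]
        isometry[OF le0, folded One_nat_def]
      by (simp add: \<eta>_def)
  qed
  \<comment> \<open>The prepended 0 is the error before the initial interpolation; it shifts the
    index and produces \<open>Suc k\<close> in the bound.\<close>
  have "case_nat 0 L (Suc k) \<le> 2 * real (Suc k) * mesh_size nx ^ m * \<eta>"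
  proof (rule error_recursion[where e = "case_nat 0 e"])
    show "0 \<le> case_nat 0 e n" for n
      unfolding e_def using periodic_chain_L2[OF UV(1)] periodic_chain_L2[OF UV(2)]
        periodic_chain_L2[OF PQ(1)] periodic_chain_L2[OF PQ(2)]
      by (cases n) (auto intro!: wave_energy_nonneg)
    show "0 \<le> mesh_size nx ^ m" by (simp add: mesh_size_def)
    then show "0 \<le> \<eta>"
      unfolding \<eta>_def
      by (intro mult_nonneg_nonneg real_sqrt_ge_zero wave_energy_nonneg periodic_chain_L2[OF A]
          periodic_chain_L2[OF B]) auto
    show "\<exists>\<theta>\<ge>0. case_nat 0 e (Suc n) \<le> \<eta>\<^sup>2 + case_nat 0 e n - \<theta>\<^sup>2 \<and>
        case_nat 0 L (Suc n) \<le> case_nat 0 L n + mesh_size nx ^ m * (\<eta> + \<theta>)" for n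
      using step0 step by (cases n) simp_all
  qed simp_all
  also have "\<dots> = 2 * real (Suc k) * mesh_size nx ^ (2 * m) * sqrt (wave_energy c (A (2 * m + 1)) (B (2 * m)))"
  proof -
    have "mesh_size nx ^ (2 * m) = mesh_size nx ^ m * mesh_size nx ^ m"
      by (simp only: mult_2 power_add)
    then show ?thesis by (simp only: \<eta>_def mult_ac)
  qed
  finally have "L k \<le> 2 * real (Suc k) * mesh_size nx ^ (2 * m)
      * sqrt (wave_energy c (A (2 * m + 1)) (B (2 * m)))" by (simp only: nat.case)
  then show ?thesis by (simp only: L_def U_def V_def P_def Q_def \<tau>_def eq fst_conv snd_conv)
qed

theorem theorem1:
  fixes m :: nat and c T lam :: real
  assumes "1 \<le> m" and "0 < c" and "0 < T" and "0 < lam" and "lam < 1"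
  shows "\<exists>C. \<forall>(nx :: nat) (dt :: real) g0 g1 u v (k :: nat).
           1 \<le> nx \<longrightarrow>
           c * dt / mesh_size nx = lam \<longrightarrow>
           g0 \<in> H_per (2 * m + 1) \<longrightarrow>
           g1 \<in> H_per (2 * m) \<longrightarrow>
           wave_solution c u v \<longrightarrow> u 0 = g0 \<longrightarrow> v 0 = g1 \<longrightarrow>
           real k / 2 * dt \<le> T \<longrightarrow>
           (let t = real k / 2 * dt;
                (p, q) = hermite_method m c nx dt g0 g1 k
            in L2_norm (deriv (\<lambda>x. u t x - p x)) + L2_norm (\<lambda>x. v t x - q x)
               \<le> C * mesh_size nx ^ (2 * m - 1) *
                  (L2_norm (sobolev_deriv (2 * m + 1) g0) + L2_norm (sobolev_deriv (2 * m) g1)))"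
proof -
  \<comment> \<open>The factors are the cost of recovering both norms from the energy, the factor 2
    of the recursion times a bound for \<open>(k + 1) * h\<close>, and the cost of bounding the
    energy of the data by the sum of norms. In the middle one, \<open>2 * T * c / lam\<close> bounds
    \<open>k * h\<close> for \<open>k\<close> half steps, and \<open>2 * pi\<close> bounds
    \<open>h\<close> for the initial interpolation.\<close>
  define C where "C = (1 / c + 1) * (2 * (2 * T * c / lam + 2 * pi)) * (c + 1)"
  have main: "L2_norm (deriv (\<lambda>x. u t x - p x)) + L2_norm (\<lambda>x. v t x - q x)
      \<le> C * mesh_size nx ^ (2 * m - 1) *
        (L2_norm (sobolev_deriv (2 * m + 1) g0) + L2_norm (sobolev_deriv (2 * m) g1))"
    if nx: "1 \<le> nx" and ratio: "c * dt / mesh_size nx = lam"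
      and g0: "g0 \<in> H_per (2 * m + 1)" and g1: "g1 \<in> H_per (2 * m)"
      and sol: "wave_solution c u v" and u0: "u 0 = g0" and v0: "v 0 = g1"
      and t: "t = real k / 2 * dt" "t \<le> T" and pq: "hermite_method m c nx dt g0 g1 k = (p, q)"
    for nx k :: nat and dt t :: real and g0 g1 p q u v
  proof -
    define h where "h = mesh_size nx"
    have h: "0 < h" "h \<le> 2 * pi"
      using nx by (auto simp: h_def mesh_size_def field_simps)
    have dt: "dt = lam * h / c" using ratio h assms by (auto simp: h_def field_simps)
    then have dt0: "0 < dt" using h assms by simp
    obtain A where A: "periodic_chain (2 * m + 1) A" "A 0 = g0" "A (2 * m + 1) = sobolev_deriv (2 * m + 1) g0"
      using sobolev_deriv_chain[OF g0] by blast
    obtain B where B: "periodic_chain (2 * m) B" "B 0 = g1" "B (2 * m) = sobolev_deriv (2 * m) g1"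
      using sobolev_deriv_chain[OF g1] by blast
    obtain P Q where PQ: "method_chains m c nx dt (A 0) (B 0) k = (P, Q)" by fastforce
    have per: "periodic (A 0)" "periodic (B 0)"
      using periodic_chain_periodic[OF A(1)] periodic_chain_periodic[OF B(1)] by auto
    note correct = method_chains_correct[OF assms(1) nx assms(2) less_imp_le[OF dt0] per PQ]
    have pq': "p = P 0" "q = Q 0" using correct(3) pq A(2) B(2) by auto
    define U where "U = wave_chain_u c t A B"
    define V where "V = wave_chain_v c t A B"
    have A': "periodic_chain (Suc (2 * m)) A" using A(1) by simp
    have t0: "0 \<le> t" using dt0 unfolding t(1) by simp
    have UV: "periodic_chain (Suc (2 * m)) U" "periodic_chain (2 * m) V"
      unfolding U_def V_def by (rule periodic_chain_wave_u[OF A' B(1)] periodic_chain_wave_v[OF A' B(1)])+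
    have "u t = U 0 \<and> v t = V 0"
    proof -
      have "wave_solution c (\<lambda>t. wave_chain_u c t A B 0) (\<lambda>t. wave_chain_v c t A B 0)"
        by (rule wave_solution_chain[OF A' B(1)]) (use assms in auto)
      then show ?thesis
        using wave_solution_unique[OF sol _ assms(2) _ _ t0] u0 v0 A(2) B(2)
        by (simp add: U_def V_def wave_chain_u_def wave_chain_v_def)
    qed
    then have uv: "u t = U 0" "v t = V 0" by auto
    have L: "locally_L2 (\<lambda>x. U 1 x - P 1 x)" "locally_L2 (\<lambda>x. V 0 x - Q 0 x)"
      using periodic_chain_L2[OF UV(1), of 1] periodic_chain_L2[OF UV(2), of 0]
        periodic_chain_L2[OF correct(1), of 1] periodic_chain_L2[OF correct(2), of 0]
      by (auto intro!: locally_L2_diff)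
    \<comment> \<open>Since \<open>1 \<le> m\<close>, both chains have order at least 2, so these
      are classical derivatives at every point, nodes included.\<close>
    have deriv: "deriv (\<lambda>x. u t x - p x) = (\<lambda>x. U 1 x - P 1 x)"
    proof
      fix x
      have "(U 0 has_real_derivative U 1 x) (at x)" "(P 0 has_real_derivative P 1 x) (at x)"
        using sobolev_chain_has_deriv[of _ U 0 x] sobolev_chain_has_deriv[of _ P 0 x] UV(1) correct(1) assms(1)
        by (auto simp: periodic_chain_def)
      then show "deriv (\<lambda>x. u t x - p x) x = U 1 x - P 1 x"
        unfolding uv pq' by (intro DERIV_imp_deriv DERIV_diff)
    qed
    define E where "E = sqrt (wave_energy c (\<lambda>x. U 1 x - P 1 x) (\<lambda>x. V 0 x - Q 0 x))"
    define S where "S = sqrt (wave_energy c (A (2 * m + 1)) (B (2 * m)))"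
    define N where "N = L2_norm (sobolev_deriv (2 * m + 1) g0) + L2_norm (sobolev_deriv (2 * m) g1)"
    have energy_eq: "wave_energy c f g = (c * L2_norm f)\<^sup>2 + (L2_norm g)\<^sup>2"
      if "locally_L2 f" "locally_L2 g" for f g
      using that integral_square_nonneg
      by (simp add: wave_energy_def L2_norm_eq power_mult_distrib)
    have nn: "0 \<le> L2_norm f" if "locally_L2 f" for f
      using that integral_square_nonneg by (simp add: L2_norm_eq)
    have 1: "c * L2_norm (deriv (\<lambda>x. u t x - p x)) \<le> E" "L2_norm (\<lambda>x. v t x - q x) \<le> E"
      unfolding deriv unfolding uv pq' E_def energy_eq[OF L]
      by (simp_all add: real_le_rsqrt)
    have E: "E \<le> 2 * real (Suc k) * h ^ (2 * m) * S"
      using hermite_method_energy_error[OF assms(1) nx assms(2) less_imp_le[OF dt0] A(1) B(1) PQ]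
      by (simp add: E_def S_def U_def V_def t h_def)
    have LA: "locally_L2 (A (2 * m + 1))" "locally_L2 (B (2 * m))"
      using periodic_chain_L2[OF A(1)] periodic_chain_L2[OF B(1)] by auto
    have S: "S \<le> (c + 1) * N"
    proof -
      have "S \<le> c * L2_norm (A (2 * m + 1)) + L2_norm (B (2 * m))"
        unfolding S_def energy_eq[OF LA]
        using sqrt_sum_squares_le_sum[of "c * L2_norm (A (2 * m + 1))" "L2_norm (B (2 * m))"] nn[OF LA(1)] nn[OF LA(2)] assms(2)
        by simp
      also have "\<dots> \<le> (c + 1) * N"
        using nn[OF LA(1)] nn[OF LA(2)] assms(2) unfolding N_def A(3)[symmetric] B(3)[symmetric]
        by (simp add: algebra_simps)
      finally show ?thesis .
    qed
    have N0: "0 \<le> N"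
      using nn[OF LA(1)] nn[OF LA(2)] unfolding N_def A(3)[symmetric] B(3)[symmetric] by simp
    have steps: "real (Suc k) * h \<le> 2 * T * c / lam + 2 * pi"
    proof -
      have "real k * dt \<le> 2 * T" using t by (simp add: field_simps)
      then have "real k * (lam * h / c) \<le> 2 * T" unfolding dt .
      then have "real k * h \<le> 2 * T * c / lam" using assms by (simp add: field_simps)
      then show ?thesis using h(2) by (simp add: algebra_simps)
    qed
    \<comment> \<open>One power of \<open>h\<close> is set aside to absorb the number of
      steps.\<close>
    have "h ^ (2 * m) = h * h ^ (2 * m - 1)"
      using assms(1) by (cases m) simp_all
    then have "2 * real (Suc k) * h ^ (2 * m) * S = 2 * (real (Suc k) * h) * h ^ (2 * m - 1) * S"
      by simp
    also have "\<dots> \<le> 2 * (2 * T * c / lam + 2 * pi) * h ^ (2 * m - 1) * ((c + 1) * N)"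
      using steps S h assms N0 wave_energy_nonneg[OF LA, of c]
      by (intro mult_mono mult_nonneg_nonneg add_nonneg_nonneg divide_nonneg_pos) (auto simp: S_def)
    finally have E': "E \<le> 2 * (2 * T * c / lam + 2 * pi) * h ^ (2 * m - 1) * ((c + 1) * N)"
      using E by simp
    have "L2_norm (deriv (\<lambda>x. u t x - p x)) + L2_norm (\<lambda>x. v t x - q x) \<le> (1 / c + 1) * E"
    proof -
      have "L2_norm (deriv (\<lambda>x. u t x - p x)) \<le> E / c"
        using 1(1) assms(2) by (simp add: pos_le_divide_eq mult.commute)
      then show ?thesis using 1(2) by (simp add: distrib_right)
    qed
    also have "\<dots> \<le> (1 / c + 1) * (2 * (2 * T * c / lam + 2 * pi) * h ^ (2 * m - 1) * ((c + 1) * N))"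
      using E' assms(2) by (intro mult_left_mono) auto
    also have "\<dots> = C * h ^ (2 * m - 1) * N" by (simp add: C_def mult_ac)
    finally show ?thesis by (simp add: h_def N_def)
  qed
  show ?thesis
  proof (intro exI[of _ C] allI impI, goal_cases)
    case (1 nx dt g0 g1 u v k)
    obtain p q where pq: "hermite_method m c nx dt g0 g1 k = (p, q)" by fastforce
    show ?case
      unfolding pq Let_def prod.case using main[OF 1(1-7) refl 1(8) pq] .
  qed
qed

end
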